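(* Let $d,k$ be positive integers and $d':=(3\lceil\sqrt d\rceil)^d k$. Every subgraph $H$ of a unit $d$-dimensional ball graph $G$ with clique number $k$ has twin-width at most $d'$. Furthermore, if $G$ comes with a geometric representation (coordinates of the centers of the balls), then a $d'$-contraction sequence of $H$ can be found in polynomial time.
   Context: A unit $d$-dimensional ball graph is the intersection graph of a finite family of closed balls of radius 1 in $\mathbb R^d$: vertices are the balls (equivalently their centers) and two vertices are adjacent iff the balls intersect (centers at Euclidean distance at most 2). The clique number is the maximum size of a clique. A subgraph need not be induced. Twin-width: a trigraph is $(V,E,R)$ with disjoint black edge set $E$ and red edge set $R$; a graph $(V,E)$ is $(V,E,\emptyset)$. Contracting distinct vertices $u,v$ replaces them by a new vertex $w$, keeps the rest unchanged, and for every other $x$: $wx$ is black iff $ux,vx$ are both black; $wx$ is absent iff neither $ux$ nor $vx$ is black or red; $wx$ is red otherwise. A $d'$-contraction sequence of an $m$-vertex graph $H$ is a sequence $H=H_m,\ldots,H_1$ of single contractions ending in one vertex with every $H_i$ of maximum red degree at most $d'$; the twin-width is the least such $d'$. *)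

theory Defs
  imports "HOL-Analysis.Analysis" "HOL-Computational_Algebra.Polynomial" "HOL-Library.Log_Nat"
begin

section \<open>Graphs and unit ball graphs\<close>

type_synonym 'a graph = "'a set \<times> 'a set set"

definition simple_graph :: "'a graph \<Rightarrow> bool" where
  "simple_graph G \<longleftrightarrow> finite (fst G) \<and>
     snd G \<subseteq> {{u, v} | u v. u \<in> fst G \<and> v \<in> fst G \<and> u \<noteq> v}"

definition subgraph :: "'a graph \<Rightarrow> 'a graph \<Rightarrow> bool" where
  "subgraph H G \<longleftrightarrow> simple_graph H \<and> fst H \<subseteq> fst G \<and> snd H \<subseteq> snd G"

definition clique :: "'a graph \<Rightarrow> 'a set \<Rightarrow> bool" where
  "clique G C \<longleftrightarrow> C \<subseteq> fst G \<and> (\<forall>u\<in>C. \<forall>v\<in>C. u \<noteq> v \<longrightarrow> {u, v} \<in> snd G)"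

definition clique_number :: "'a graph \<Rightarrow> nat" where
  "clique_number G = Max (card ` {C. clique G C})"

text \<open>The dimension \<open>d\<close> is a number rather than a type, since one algorithm has to serve all
  dimensions. Euclidean \<open>d\<close>-space is the library's \<open>topspace (Euclidean_space d)\<close>: the functions
  \<open>nat \<Rightarrow> real\<close> that vanish at all indices \<open>\<ge> d\<close>.\<close>

definition unit_ball :: "nat \<Rightarrow> (nat \<Rightarrow> real) \<Rightarrow> (nat \<Rightarrow> real) set" where
  "unit_ball d p = {x \<in> topspace (Euclidean_space d). L2_set (\<lambda>i. x i - p i) {..<d} \<le> 1}"

text \<open>The balls form a family indexed by \<open>V\<close>, so that distinct vertices may have equal balls.\<close>

definition ball_graph :: "nat \<Rightarrow> 'a set \<Rightarrow> ('a \<Rightarrow> nat \<Rightarrow> real) \<Rightarrow> 'a graph" where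
  "ball_graph d V c =
     (V, {{u, v} | u v. u \<in> V \<and> v \<in> V \<and> u \<noteq> v \<and> unit_ball d (c u) \<inter> unit_ball d (c v) \<noteq> {}})"

definition is_unit_ball_graph :: "nat \<Rightarrow> 'a graph \<Rightarrow> bool" where
  "is_unit_ball_graph d G \<longleftrightarrow> finite (fst G) \<and>
     (\<exists>c \<in> fst G \<rightarrow> topspace (Euclidean_space d). G = ball_graph d (fst G) c)"

lemma unit_balls_meet_iff:
  assumes p: "p \<in> topspace (Euclidean_space d)" and q: "q \<in> topspace (Euclidean_space d)"
  shows "unit_ball d p \<inter> unit_ball d q \<noteq> {} \<longleftrightarrow> L2_set (\<lambda>i. p i - q i) {..<d} \<le> 2"
proof
  assume "unit_ball d p \<inter> unit_ball d q \<noteq> {}"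
  then obtain x where x: "L2_set (\<lambda>i. x i - p i) {..<d} \<le> 1" "L2_set (\<lambda>i. x i - q i) {..<d} \<le> 1"
    by (auto simp: unit_ball_def)
  have "L2_set (\<lambda>i. p i - q i) {..<d} = L2_set (\<lambda>i. (p i - x i) + (x i - q i)) {..<d}"
    by simp
  also have "\<dots> \<le> L2_set (\<lambda>i. p i - x i) {..<d} + L2_set (\<lambda>i. x i - q i) {..<d}"
    by (rule L2_set_triangle_ineq)
  also have "L2_set (\<lambda>i. p i - x i) {..<d} = L2_set (\<lambda>i. x i - p i) {..<d}"
    by (simp add: L2_set_def power2_commute)
  finally show "L2_set (\<lambda>i. p i - q i) {..<d} \<le> 2" using x by simp
next
  assume le: "L2_set (\<lambda>i. p i - q i) {..<d} \<le> 2"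
  define m where "m = (\<lambda>i. (1/2) * (p i + q i))"
  have half: "L2_set (\<lambda>i. (1/2) * (p i - q i)) {..<d} \<le> 1"
    using le L2_set_right_distrib [of "1/2" "\<lambda>i. p i - q i" "{..<d}"] by simp
  have "L2_set (\<lambda>i. m i - q i) {..<d} = L2_set (\<lambda>i. (1/2) * (p i - q i)) {..<d}"
    by (simp add: m_def field_simps)
  moreover have "L2_set (\<lambda>i. m i - p i) {..<d} = L2_set (\<lambda>i. (1/2) * (p i - q i)) {..<d}"
  proof -
    have "(m i - p i)\<^sup>2 = ((1/2) * (p i - q i))\<^sup>2" for i
      by (simp add: m_def power2_eq_square field_simps)
    then show ?thesis by (simp add: L2_set_def)
  qed
  moreover have "m \<in> topspace (Euclidean_space d)"
    using p q by (simp add: m_def topspace_Euclidean_space)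
  ultimately have "m \<in> unit_ball d p \<inter> unit_ball d q"
    using half by (simp add: unit_ball_def)
  then show "unit_ball d p \<inter> unit_ball d q \<noteq> {}" by blast
qed


section \<open>Trigraphs and twin-width\<close>

record 'a trigraph =
  verts :: "'a set"
  black :: "'a set set"
  red :: "'a set set"

definition trigraph_of :: "'a graph \<Rightarrow> 'a trigraph" where
  "trigraph_of G = \<lparr>verts = fst G, black = snd G, red = {}\<rparr>"

definition red_degree :: "'a trigraph \<Rightarrow> 'a \<Rightarrow> nat" where
  "red_degree T x = card {y. {x, y} \<in> red T}"

text \<open>The name \<open>w\<close> of the new vertex may be any element that is not one of the remaining vertices;
  in particular a name that has just become free (\<open>u\<close> or \<open>v\<close>) may be used again.\<close>

definition contractible :: "'a \<Rightarrow> 'a \<Rightarrow> 'a \<Rightarrow> 'a trigraph \<Rightarrow> bool" where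
  "contractible u v w T \<longleftrightarrow>
     u \<in> verts T \<and> v \<in> verts T \<and> u \<noteq> v \<and> w \<notin> verts T - {u, v}"

definition contract :: "'a \<Rightarrow> 'a \<Rightarrow> 'a \<Rightarrow> 'a trigraph \<Rightarrow> 'a trigraph" where
  "contract u v w T =
     (let W = verts T - {u, v};
          B = {x \<in> W. {u, x} \<in> black T \<and> {v, x} \<in> black T};
          N = {x \<in> W. {u, x} \<notin> black T \<union> red T \<and> {v, x} \<notin> black T \<union> red T}
      in \<lparr>verts = insert w W,
          black = {e \<in> black T. u \<notin> e \<and> v \<notin> e} \<union> {{w, x} | x. x \<in> B},
          red = {e \<in> red T. u \<notin> e \<and> v \<notin> e} \<union> {{w, x} | x. x \<in> W - B - N}\<rparr>)"

text \<open>A contraction sequence is given by the triples \<open>(u, v, w)\<close> of its successive contractions; they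
  determine the trigraphs \<open>H\<^sub>m, \<dots>, H\<^sub>1\<close>, all of which are subject to the degree bound.\<close>

fun contraction_sequence :: "nat \<Rightarrow> 'a trigraph \<Rightarrow> ('a \<times> 'a \<times> 'a) list \<Rightarrow> bool" where
  "contraction_sequence D T [] \<longleftrightarrow>
     (\<forall>x\<in>verts T. red_degree T x \<le> D) \<and> card (verts T) = 1"
| "contraction_sequence D T ((u, v, w) # cs) \<longleftrightarrow>
     (\<forall>x\<in>verts T. red_degree T x \<le> D) \<and> contractible u v w T \<and>
     contraction_sequence D (contract u v w T) cs"

definition twin_width :: "'a graph \<Rightarrow> nat" where
  "twin_width G = (LEAST D. \<exists>cs. contraction_sequence D (trigraph_of G) cs)"


section \<open>Random access machines and polynomial time\<close>

text \<open>Structured programs for a random access machine whose cells hold elements of an ordered field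
  \<open>'a\<close>. The memory is a family of arrays, and \<open>Rd a e\<close> and \<open>Write a e e'\<close> address the cell of array
  \<open>a\<close> at the (computed) index \<open>e\<close>; a program mentions only finitely many arrays. Indices are
  elements of \<open>'a\<close> too. Arrays with arbitrary field elements as indices add no more than polynomial
  power, since the finitely many cells in use can be kept in a searchable list.\<close>

datatype exp =
    Const int
  | Rd nat exp
  | Add exp exp
  | Sub exp exp
  | Mul exp exp
  | Div exp exp

datatype cnd =
    Less exp exp
  | Neg cnd
  | Conj cnd cnd

datatype com =
    Skip
  | Write nat exp exp
  | Seq com com
  | Cond cnd com com
  | While cnd com

type_synonym 'a store = "nat \<Rightarrow> 'a \<Rightarrow> 'a"

fun val :: "exp \<Rightarrow> 'a::linordered_field store \<Rightarrow> 'a" where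
  "val (Const z) s = of_int z"
| "val (Rd a e) s = s a (val e s)"
| "val (Add e f) s = val e s + val f s"
| "val (Sub e f) s = val e s - val f s"
| "val (Mul e f) s = val e s * val f s"
| "val (Div e f) s = val e s / val f s"

fun holds :: "cnd \<Rightarrow> 'a::linordered_field store \<Rightarrow> bool" where
  "holds (Less e f) s \<longleftrightarrow> val e s < val f s"
| "holds (Neg b) s \<longleftrightarrow> \<not> holds b s"
| "holds (Conj b b') s \<longleftrightarrow> holds b s \<and> holds b' s"

text \<open>Every field element that is handled, indices included, is charged its weight under \<open>w\<close>.\<close>

fun cost :: "('a::linordered_field \<Rightarrow> nat) \<Rightarrow> exp \<Rightarrow> 'a store \<Rightarrow> nat" where
  "cost w (Const z) s = w (of_int z)"
| "cost w (Rd a e) s = cost w e s + w (val (Rd a e) s)"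
| "cost w (Add e f) s = cost w e s + cost w f s + w (val (Add e f) s)"
| "cost w (Sub e f) s = cost w e s + cost w f s + w (val (Sub e f) s)"
| "cost w (Mul e f) s = cost w e s + cost w f s + w (val (Mul e f) s)"
| "cost w (Div e f) s = cost w e s + cost w f s + w (val (Div e f) s)"

fun cost_cnd :: "('a::linordered_field \<Rightarrow> nat) \<Rightarrow> cnd \<Rightarrow> 'a store \<Rightarrow> nat" where
  "cost_cnd w (Less e f) s = cost w e s + cost w f s + 1"
| "cost_cnd w (Neg b) s = cost_cnd w b s + 1"
| "cost_cnd w (Conj b b') s = cost_cnd w b s + cost_cnd w b' s + 1"

text \<open>\<open>exec w c s t s'\<close>: program \<open>c\<close>, started in \<open>s\<close>, halts in \<open>s'\<close> at total cost \<open>t\<close>.\<close>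

inductive exec ::
  "('a::linordered_field \<Rightarrow> nat) \<Rightarrow> com \<Rightarrow> 'a store \<Rightarrow> nat \<Rightarrow> 'a store \<Rightarrow> bool" for w where
  Skip: "exec w Skip s 1 s"
| Write: "exec w (Write a e f) s (cost w e s + cost w f s + 1)
            (s(a := (s a)(val e s := val f s)))"
| Seq: "exec w c s t s' \<Longrightarrow> exec w c' s' t' s'' \<Longrightarrow> exec w (Seq c c') s (t + t' + 1) s''"
| CondTrue: "holds b s \<Longrightarrow> exec w c s t s' \<Longrightarrow> exec w (Cond b c c') s (cost_cnd w b s + t + 1) s'"
| CondFalse: "\<not> holds b s \<Longrightarrow> exec w c' s t s' \<Longrightarrow> exec w (Cond b c c') s (cost_cnd w b s + t + 1) s'"
| WhileFalse: "\<not> holds b s \<Longrightarrow> exec w (While b c) s (cost_cnd w b s + 1) s"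
| WhileTrue: "holds b s \<Longrightarrow> exec w c s t s' \<Longrightarrow> exec w (While b c) s' t' s'' \<Longrightarrow>
     exec w (While b c) s (cost_cnd w b s + t + t' + 1) s''"

lemma exec_deterministic:
  "exec w c s t s' \<Longrightarrow> exec w c s u s'' \<Longrightarrow> t = u \<and> s' = s''"
proof (induction arbitrary: u s'' rule: exec.induct)
  case (Seq c s t s' c' t' s1) from Seq.prems show ?case
    by (cases rule: exec.cases) (use Seq.IH in blast)+
next
  case (WhileTrue b s c t s' t' s1) from WhileTrue.prems show ?case
    by (cases rule: exec.cases) (use WhileTrue.IH WhileTrue.hyps in blast)+
qed (erule exec.cases; force)+

definition holds_list :: "'a::linordered_field store \<Rightarrow> nat \<Rightarrow> 'a list \<Rightarrow> bool" where
  "holds_list s a xs \<longleftrightarrow>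
     s a 0 = of_nat (length xs) \<and> (\<forall>i<length xs. s a (of_nat (Suc i)) = xs ! i)"

text \<open>The input list is in array 0, preceded by its length; all other cells are 0.\<close>

definition init_store :: "'a::linordered_field list \<Rightarrow> 'a store" where
  "init_store xs = (\<lambda>a i. 0)(0 := (\<lambda>i.
     case map_of (zip (map of_nat [0..<Suc (length xs)]) (of_nat (length xs) # xs)) i of
       None \<Rightarrow> 0 | Some x \<Rightarrow> x))"

lemma init_store_holds_list: "holds_list (init_store xs) 0 xs"
proof -
  let ?ks = "map of_nat [0..<Suc (length xs)] :: 'a list"
  have "map_of (zip ?ks (of_nat (length xs) # xs)) (?ks ! i) = Some ((of_nat (length xs) # xs) ! i)"
    if "i < Suc (length xs)" for i
    using that by (intro map_of_zip_nth) (auto simp: distinct_map inj_on_def simp del: upt_Suc)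
  then have *: "map_of (zip ?ks (of_nat (length xs) # xs)) (of_nat i) =
      Some ((of_nat (length xs) # xs) ! i)" if "i < Suc (length xs)" for i
    using that by (metis add_0 diff_zero length_upt nth_map nth_upt)
  show ?thesis
    using *[of 0] *[of "Suc _"] unfolding holds_list_def init_store_def by (auto simp del: upt_Suc of_nat_Suc)
qed

text \<open>One program and one polynomial serve all instances \<open>i \<in> I\<close>. The answer is read off array 1, and
  \<open>correct i y\<close> says that \<open>y\<close> is an admissible answer for \<open>i\<close>.\<close>

definition poly_time ::
  "('a::linordered_field \<Rightarrow> nat) \<Rightarrow> 'i set \<Rightarrow> ('i \<Rightarrow> 'a list) \<Rightarrow> ('i \<Rightarrow> 'a list \<Rightarrow> bool) \<Rightarrow> bool" where
  "poly_time w I enc correct \<longleftrightarrow>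
     (\<exists>(c :: com) (p :: nat poly). \<forall>i\<in>I. \<exists>t s y.
        exec w c (init_store (enc i)) t s \<and> t \<le> poly p (sum_list (map w (enc i))) \<and>
        holds_list s 1 y \<and> correct i y)"

text \<open>Two standard cost measures: bit length, for rational data (the logarithmic cost criterion,
  polynomially equivalent to Turing machine time), and unit cost, for real data (the real RAM).\<close>

definition bit_size :: "rat \<Rightarrow> nat" where
  "bit_size q = (case quotient_of q of (a, b) \<Rightarrow>
     1 + floorlog 2 (nat \<bar>a\<bar>) + floorlog 2 (nat b))"

definition unit_size :: "real \<Rightarrow> nat" where
  "unit_size x = 1"


section \<open>The computational problem\<close>

text \<open>An instance \<open>(d, k, xs, vs, es)\<close> consists of the dimension \<open>d\<close>, the clique number \<open>k\<close> of \<open>G\<close>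
  (which is not part of the input given to the program), the centers \<open>xs\<close> of the balls as lists of
  \<open>d\<close> coordinates, and the vertices \<open>vs\<close> and edges \<open>es\<close> of \<open>H\<close>. The vertices of \<open>G\<close> are the positions
  in \<open>xs\<close>. The map \<open>r\<close> embeds the coordinates into the reals.\<close>

type_synonym 'a instance_data = "nat \<times> nat \<times> 'a list list \<times> nat list \<times> (nat \<times> nat) list"

definition listed_ball_graph :: "('a \<Rightarrow> real) \<Rightarrow> nat \<Rightarrow> 'a list list \<Rightarrow> nat graph" where
  "listed_ball_graph r d xs =
     ball_graph d {..<length xs} (\<lambda>i j. if j < d then r (xs ! i ! j) else 0)"

definition listed_graph :: "nat list \<Rightarrow> (nat \<times> nat) list \<Rightarrow> nat graph" where
  "listed_graph vs es = (set vs, {{u, v} | u v. (u, v) \<in> set es})"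

definition instances :: "('a \<Rightarrow> real) \<Rightarrow> 'a instance_data set" where
  "instances r = {(d, k, xs, vs, es).
     0 < d \<and> 0 < k \<and> (\<forall>x\<in>set xs. length x = d) \<and>
     clique_number (listed_ball_graph r d xs) = k \<and>
     vs \<noteq> [] \<and> distinct vs \<and> subgraph (listed_graph vs es) (listed_ball_graph r d xs)}"

fun encode :: "'a::linordered_field instance_data \<Rightarrow> 'a list" where
  "encode (d, k, xs, vs, es) =
     [of_nat d, of_nat (length xs)] @ concat xs @
     [of_nat (length vs)] @ map of_nat vs @
     [of_nat (length es)] @ concat (map (\<lambda>(u, v). [of_nat u, of_nat v]) es)"

definition encode_triples :: "(nat \<times> nat \<times> nat) list \<Rightarrow> 'a::linordered_field list" where
  "encode_triples cs = concat (map (\<lambda>(u, v, w). [of_nat u, of_nat v, of_nat w]) cs)"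

definition width_bound :: "nat \<Rightarrow> nat \<Rightarrow> nat" where
  "width_bound d k = (3 * nat \<lceil>sqrt (real d)\<rceil>) ^ d * k"

fun is_solution :: "'a::linordered_field instance_data \<Rightarrow> 'a list \<Rightarrow> bool" where
  "is_solution (d, k, xs, vs, es) y \<longleftrightarrow>
     (\<exists>cs. y = encode_triples cs \<and>
        contraction_sequence (width_bound d k) (trigraph_of (listed_graph vs es)) cs)"

end

theory Submission
  imports Defs
begin

text \<open>Fix a coordinate and put \<open>s = 2 / sqrt d\<close>. The level of a vertex is the largest length of a chain
  of vertices below it whose coordinates increase by steps of at least \<open>s\<close>. Two vertices of equal level
  differ by less than \<open>s\<close>, so vertices that agree in all levels (a cell) form a clique of the ball graph;
  and adjacent vertices differ by at most \<open>m = \<lceil>sqrt d\<rceil>\<close> in each level. Levels replace the usual grid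
  cells because a real RAM without floor function can compute them in polynomial time.

  As long as edges only join vertices whose levels differ by at most \<open>m\<close> and every cell has at most \<open>k\<close>
  vertices, all degrees are at most \<open>(2 * m + 1) ^ d * k \<le> (3 * m) ^ d * k\<close>. Merging vertices of the same
  cell preserves this, and so does lowering by one a level that is maximal in its coordinate, provided that
  the vertex is merged at once with the one it may meet in its new cell. Once every cell
  has at most one vertex, sweeping all levels down to \<open>0\<close>, one coordinate after the other, leaves a single
  vertex.\<close>

section \<open>Contracting vertices placed in cells\<close>

text \<open>Lowering a level changes the positions, not the trigraph. This settles the critical
  moment at which a lowered vertex \<open>v\<close> enters the cell of another vertex
  \<open>u\<close>, which for \<open>k = 1\<close> breaks the bound on cells. The red degrees before
  the contraction of \<open>u\<close> and \<open>v\<close> are bounded with the old positions; those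
  after it as well, because old and new positions agree once \<open>v\<close> is gone. The new
  positions serve only to see that \<open>u\<close> may inherit the edges of \<open>v\<close>. The
  sweep occurs twice. The mere existence of a sequence is an induction on the sum of all levels plus
  the number of vertices, where any maximal level may be chosen. The program follows a fixed
  schedule instead and never searches for a maximum: in pass \<open>l\<close> over a coordinate it
  lowers the vertices at level \<open>n - l\<close>, which no remaining vertex exceeds. Its
  decisions use neither \<open>k\<close> nor \<open>m\<close>; both enter only the proof of the
  degree bound. The square root in \<open>s\<close> disappears by squaring the comparison of
  coordinates.\<close>

definition near :: "nat \<Rightarrow> nat \<Rightarrow> ('a \<Rightarrow> nat \<Rightarrow> nat) \<Rightarrow> 'a \<Rightarrow> 'a \<Rightarrow> bool" where
  "near d m p x y \<longleftrightarrow> (\<forall>i<d. p x i \<le> p y i + m \<and> p y i \<le> p x i + m)"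

definition same_cell :: "nat \<Rightarrow> ('a \<Rightarrow> nat \<Rightarrow> nat) \<Rightarrow> 'a \<Rightarrow> 'a \<Rightarrow> bool" where
  "same_cell d p x y \<longleftrightarrow> (\<forall>i<d. p x i = p y i)"

text \<open>Both colours obey the same condition, since a contraction may turn black edges red. That
  the ends are vertices is included because \<open>red_degree\<close> counts arbitrary
  \<open>y\<close>.\<close>

definition placed :: "nat \<Rightarrow> nat \<Rightarrow> ('a \<Rightarrow> nat \<Rightarrow> nat) \<Rightarrow> 'a trigraph \<Rightarrow> bool" where
  "placed d m p T \<longleftrightarrow> finite (verts T) \<and>
     (\<forall>e \<in> black T \<union> red T. \<exists>x\<in>verts T. \<exists>y\<in>verts T. x \<noteq> y \<and> e = {x, y} \<and> near d m p x y)"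

definition cells_le :: "nat \<Rightarrow> nat \<Rightarrow> ('a \<Rightarrow> nat \<Rightarrow> nat) \<Rightarrow> 'a set \<Rightarrow> bool" where
  "cells_le d k p A \<longleftrightarrow> (\<forall>x\<in>A. card {y\<in>A. same_cell d p y x} \<le> k)"

lemma near_sym: "near d m p x y \<Longrightarrow> near d m p y x"
  by (auto simp: near_def)

lemma placed_edge:
  assumes "placed d m p T" "{x, y} \<in> black T \<union> red T"
  shows "x \<in> verts T" "y \<in> verts T" "x \<noteq> y" "near d m p x y"
proof -
  obtain x' y' where *: "x' \<in> verts T" "y' \<in> verts T" "x' \<noteq> y'" "{x, y} = {x', y'}" "near d m p x' y'"
    using bspec[OF conjunct2[OF assms(1)[unfolded placed_def]] assms(2)] by (elim bexE conjE)
  then have "x = x' \<and> y = y' \<or> x = y' \<and> y = x'" by (auto simp: doubleton_eq_iff)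
  then show "x \<in> verts T" "y \<in> verts T" "x \<noteq> y" "near d m p x y"
    using * near_sym[of d m p x' y'] by auto
qed

text \<open>The cells near \<open>x\<close> form a box of \<open>d\<close> intervals with at most
  \<open>2 * m + 1\<close> values each (truncated subtraction only shortens them), and each fibre of
  the map \<open>f\<close> from vertices to cells has at most \<open>k\<close> elements.\<close>

lemma card_near_le:
  assumes fin: "finite A" and cells: "cells_le d k p A"
  shows "card {y\<in>A. near d m p x y} \<le> (2 * m + 1) ^ d * k"
proof -
  define C where "C = {y\<in>A. near d m p x y}"
  define f where "f y = restrict (p y) {..<d}" for y
  define P where "P = (\<Pi>\<^sub>E i\<in>{..<d}. {p x i - m..p x i + m})"
  have C: "finite C" using fin by (simp add: C_def)
  have sub: "f ` C \<subseteq> P"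
    unfolding f_def P_def C_def near_def by (intro image_subsetI restrict_PiE) auto
  have finP: "finite P" unfolding P_def by (intro finite_PiE) auto
  have "card P = (\<Prod>i<d. card {p x i - m..p x i + m})"
    unfolding P_def by (simp add: card_PiE)
  also have "\<dots> \<le> (\<Prod>i<d. 2 * m + 1)"
    by (intro prod_mono) auto
  finally have cP: "card P \<le> (2 * m + 1) ^ d" by simp
  have fib: "card {z \<in> C. f z = g} \<le> k" if "g \<in> f ` C" for g
  proof -
    from that obtain y where y: "y \<in> C" "g = f y" by blast
    have "{z \<in> C. f z = g} \<subseteq> {z\<in>A. same_cell d p z y}"
    proof
      fix z assume z: "z \<in> {z \<in> C. f z = g}"
      have "p z i = p y i" if "i < d" for i
      proof -
        have "f z i = f y i" using z y by simp
        then show ?thesis using that by (simp add: f_def)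
      qed
      then show "z \<in> {z\<in>A. same_cell d p z y}" using z by (simp add: C_def same_cell_def)
    qed
    then have "card {z \<in> C. f z = g} \<le> card {z\<in>A. same_cell d p z y}"
      using fin by (intro card_mono) auto
    also have "\<dots> \<le> k" using cells y by (auto simp: cells_le_def C_def)
    finally show ?thesis .
  qed
  have "card C = (\<Sum>g\<in>f ` C. card {z \<in> C. f z = g})"
    using sum.image_gen[OF C, of "\<lambda>_. 1::nat" f] by simp
  also have "\<dots> \<le> (\<Sum>g\<in>f ` C. k)" using fib by (intro sum_mono) auto
  also have "\<dots> = card (f ` C) * k" by simp
  also have "\<dots> \<le> (2 * m + 1) ^ d * k"
    using card_mono[OF finP sub] cP by (intro mult_right_mono) auto
  finally show ?thesis by (simp add: C_def)
qed

text \<open>Origin of the factor \<open>3\<close>: \<open>2 * m + 1 \<le> 3 * m\<close> as soon as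
  \<open>1 \<le> m\<close>.\<close>

lemma red_degree_placed_le:
  assumes "placed d m p T" "cells_le d k p (verts T)" "1 \<le> m"
  shows "red_degree T x \<le> (3 * m) ^ d * k"
proof -
  have fin: "finite (verts T)" using assms(1) by (simp add: placed_def)
  have "red_degree T x \<le> card {y\<in>verts T. near d m p x y}"
    unfolding red_degree_def using placed_edge[OF assms(1)] fin
    by (intro card_mono) auto
  also have "\<dots> \<le> (2 * m + 1) ^ d * k" by (rule card_near_le[OF fin assms(2)])
  also have "\<dots> \<le> (3 * m) ^ d * k"
    using assms(3) by (intro mult_right_mono power_mono) auto
  finally show ?thesis .
qed

lemma verts_contract: "v \<noteq> u \<Longrightarrow> u \<in> verts T \<Longrightarrow> verts (contract u v u T) = verts T - {v}"
  by (auto simp: contract_def Let_def)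

text \<open>Nearness depends on the cell only, so the edges of \<open>v\<close> may be attached to
  \<open>u\<close>. As the merged vertex reuses the name \<open>u\<close>, the positions need no
  update.\<close>

lemma placed_contract:
  assumes pl: "placed d m p T" and u: "u \<in> verts T" and v: "v \<in> verts T" "u \<noteq> v"
    and same: "same_cell d p u v"
  shows "placed d m p (contract u v u T)"
proof -
  let ?T = "contract u v u T"
  have vs: "verts ?T = verts T - {v}" using verts_contract u v by metis
  have "\<exists>x\<in>verts ?T. \<exists>y\<in>verts ?T. x \<noteq> y \<and> e = {x, y} \<and> near d m p x y"
    if e: "e \<in> black ?T \<union> red ?T" for e
  proof (cases "e \<in> black T \<union> red T \<and> u \<notin> e \<and> v \<notin> e")
    case True
    with pl have "\<exists>x\<in>verts T. \<exists>y\<in>verts T. x \<noteq> y \<and> e = {x, y} \<and> near d m p x y"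
      by (simp add: placed_def)
    then obtain x y where xy: "x \<in> verts T" "y \<in> verts T" "x \<noteq> y" "e = {x, y}" "near d m p x y"
      by (elim bexE conjE)
    then have "x \<in> verts ?T" "y \<in> verts ?T" using True vs by auto
    with xy show ?thesis by (intro bexI[of _ x] bexI[of _ y] conjI)
  next
    case False
    with e obtain x where x: "e = {u, x}" "x \<in> verts T - {u, v}"
      "{u, x} \<in> black T \<union> red T \<or> {v, x} \<in> black T \<union> red T"
      by (auto simp: contract_def Let_def)
    then have "near d m p u x \<or> near d m p v x" using placed_edge(4)[OF pl] by blast
    moreover have "near d m p u x = near d m p v x" using same by (simp add: near_def same_cell_def)
    ultimately have "near d m p u x" by simp
    moreover have "u \<in> verts ?T" "x \<in> verts ?T" "u \<noteq> x" using x(2) u v(2) vs by auto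
    ultimately show ?thesis using x(1) by (intro bexI[of _ u] bexI[of _ x] conjI)
  qed
  then show ?thesis using pl vs by (simp add: placed_def)
qed

lemma placed_cong:
  assumes "placed d m p T" "\<And>x. x \<in> verts T \<Longrightarrow> p' x = p x"
  shows "placed d m p' T"
  unfolding placed_def
proof (intro conjI ballI)
  show "finite (verts T)" using assms(1) by (simp add: placed_def)
next
  fix e assume "e \<in> black T \<union> red T"
  with assms(1) have "\<exists>x\<in>verts T. \<exists>y\<in>verts T. x \<noteq> y \<and> e = {x, y} \<and> near d m p x y"
    by (simp add: placed_def)
  then show "\<exists>x\<in>verts T. \<exists>y\<in>verts T. x \<noteq> y \<and> e = {x, y} \<and> near d m p' x y"
    using assms(2) by (simp add: near_def cong: bex_cong)
qed

text \<open>A vertex of maximal level comes closer to everything strictly below it and recedes only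
  from vertices on its own level, up to a difference of \<open>1 \<le> m\<close>. At level
  \<open>0\<close> truncated subtraction changes nothing.\<close>

lemma placed_lower:
  assumes pl: "placed d m p T" and m: "1 \<le> m"
    and le: "\<And>x. x \<in> verts T \<Longrightarrow> p x j \<le> p v j"
  shows "placed d m (p(v := (p v)(j := p v j - 1))) T"
proof -
  let ?p = "p(v := (p v)(j := p v j - 1))"
  have "near d m ?p x y" if "x \<in> verts T" "y \<in> verts T" "near d m p x y" for x y
    unfolding near_def
  proof (intro allI impI)
    fix i assume "i < d"
    then have "p x i \<le> p y i + m" "p y i \<le> p x i + m" using that by (auto simp: near_def)
    then show "?p x i \<le> ?p y i + m \<and> ?p y i \<le> ?p x i + m"
      using le[OF that(1)] le[OF that(2)] m by auto
  qed
  then show ?thesis using pl unfolding placed_def by meson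
qed

lemma cells_le_one:
  assumes "finite A" "\<And>x y. x \<in> A \<Longrightarrow> y \<in> A \<Longrightarrow> same_cell d p x y \<Longrightarrow> x = y" "0 < k"
  shows "cells_le d k p A"
  unfolding cells_le_def
proof
  fix x assume "x \<in> A"
  with assms(2) have "{y \<in> A. same_cell d p y x} \<subseteq> {x}" by blast
  then have "card {y \<in> A. same_cell d p y x} \<le> card {x}" by (intro card_mono) auto
  with assms(3) show "card {y \<in> A. same_cell d p y x} \<le> k" by simp
qed

lemma cells_le_subset:
  assumes "cells_le d k p A" "finite A" "B \<subseteq> A"
  shows "cells_le d k p B"
  unfolding cells_le_def
proof
  fix x assume "x \<in> B"
  have "card {y \<in> B. same_cell d p y x} \<le> card {y \<in> A. same_cell d p y x}"
    using assms by (intro card_mono) auto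
  with assms \<open>x \<in> B\<close> show "card {y \<in> B. same_cell d p y x} \<le> k"
    unfolding cells_le_def by fastforce
qed

text \<open>The measure drops in both kinds of step: a merge removes a vertex, a lowering reduces
  one level and keeps the trigraph.\<close>

lemma contraction_sequence_exists:
  assumes "placed d m p T" "cells_le d k p (verts T)" "verts T \<noteq> {}" "1 \<le> m" "0 < k"
  shows "\<exists>cs. contraction_sequence ((3 * m) ^ d * k) T cs"
  using assms
proof (induction "(\<Sum>x\<in>verts T. \<Sum>i<d. p x i) + card (verts T)" arbitrary: p T rule: less_induct)
  case less
  let ?D = "(3 * m) ^ d * k" and ?A = "verts T"
  note pl = less.prems(1) and m = less.prems(4) and k = less.prems(5)
  have fin: "finite ?A" using pl by (simp add: placed_def)
  have deg: "\<forall>x\<in>?A. red_degree T x \<le> ?D"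
    using red_degree_placed_le[OF less.prems(1,2) m] by blast
  \<comment> \<open>\<open>q\<close> stands for positions under which \<open>u\<close> and
    \<open>v\<close> share a cell: \<open>p\<close> itself, or \<open>p\<close> with
    \<open>v\<close> lowered. Off \<open>v\<close> they agree with \<open>p\<close>, so the
    induction can continue with \<open>p\<close> after the contraction.\<close>
  have merge: ?case if uv: "u \<in> ?A" "v \<in> ?A" "u \<noteq> v" and q: "placed d m q T" "same_cell d q u v"
      "\<And>x. x \<in> ?A - {v} \<Longrightarrow> q x = p x" for u v q
  proof -
    let ?T = "contract u v u T"
    have vT: "verts ?T = ?A - {v}" using verts_contract uv by metis
    have "placed d m q ?T" using placed_contract uv q by metis
    then have plT: "placed d m p ?T" by (rule placed_cong) (use q(3) vT in auto)
    have "(\<Sum>x\<in>?A - {v}. \<Sum>i<d. p x i) \<le> (\<Sum>x\<in>?A. \<Sum>i<d. p x i)"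
      using fin by (intro sum_mono2) auto
    moreover have "card (?A - {v}) < card ?A" using fin uv(2) by (rule card_Diff1_less)
    ultimately have "(\<Sum>x\<in>?A - {v}. \<Sum>i<d. p x i) + card (?A - {v}) < (\<Sum>x\<in>?A. \<Sum>i<d. p x i) + card ?A"
      by linarith
    then obtain cs where "contraction_sequence ?D ?T cs"
      using less.hyps[of p ?T] plT cells_le_subset[OF less.prems(2) fin, of "?A - {v}"] uv m k
      unfolding vT by auto
    moreover have "contractible u v u T" using uv by (simp add: contractible_def)
    ultimately have "contraction_sequence ?D T ((u, v, u) # cs)"
      using deg by simp
    then show ?thesis ..
  qed
  show ?case
  proof (cases "\<exists>u\<in>?A. \<exists>v\<in>?A. u \<noteq> v \<and> same_cell d p u v")
    case True
    then obtain u v where "u \<in> ?A" "v \<in> ?A" "u \<noteq> v" "same_cell d p u v" by blast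
    then show ?thesis using merge[of u v p] pl by simp
  next
    case False
    then have inj: "\<And>u v. u \<in> ?A \<Longrightarrow> v \<in> ?A \<Longrightarrow> same_cell d p u v \<Longrightarrow> u = v" by blast
    show ?thesis
    proof (cases "\<exists>x\<in>?A. \<exists>j<d. 0 < p x j")
      case False
      then have "\<And>u v. u \<in> ?A \<Longrightarrow> v \<in> ?A \<Longrightarrow> u = v"
        using inj by (auto simp: same_cell_def)
      then have "card ?A = 1"
        using less.prems(3) is_singletonI'[of ?A] by (simp add: is_singleton_altdef)
      then have "contraction_sequence ?D T []" using deg by simp
      then show ?thesis ..
    next
      case True
      then obtain x j where x: "x \<in> ?A" "j < d" "0 < p x j" by blast
      have "Max ((\<lambda>y. p y j) ` ?A) \<in> (\<lambda>y. p y j) ` ?A" using fin x(1) by (intro Max_in) auto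
      then obtain v where v: "v \<in> ?A" "p v j = Max ((\<lambda>y. p y j) ` ?A)" by auto
      then have v_max: "p y j \<le> p v j" if "y \<in> ?A" for y using fin that by simp
      have pos: "0 < p v j" using v_max[OF x(1)] x(3) by linarith
      define q where "q = p(v := (p v)(j := p v j - 1))"
      have plq: "placed d m q T" unfolding q_def by (rule placed_lower[OF pl m v_max])
      show ?thesis
      proof (cases "\<exists>u\<in>?A. u \<noteq> v \<and> same_cell d q u v")
        case True
        then obtain u where "u \<in> ?A" "u \<noteq> v" "same_cell d q u v" by blast
        then show ?thesis using merge[of u v q] v(1) plq by (simp add: q_def)
      next
        case False
        have "x = y" if "x \<in> ?A" "y \<in> ?A" "same_cell d q x y" for x y
        proof (cases "x = v \<or> y = v")
          case True
          then show ?thesis using False that by (auto simp: same_cell_def)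
        next
          case False
          then show ?thesis using inj[of x y] that by (simp add: q_def same_cell_def)
        qed
        then have cq: "cells_le d k q ?A" by (rule cells_le_one[OF fin _ k])
        have "(\<Sum>i<d. q y i) \<le> (\<Sum>i<d. p y i)" for y
          by (intro sum_mono) (simp add: q_def)
        moreover have "(\<Sum>i<d. q v i) < (\<Sum>i<d. p v i)"
          using x(2) pos by (intro sum_strict_mono_ex1) (auto simp: q_def)
        ultimately have "(\<Sum>x\<in>?A. \<Sum>i<d. q x i) < (\<Sum>x\<in>?A. \<Sum>i<d. p x i)"
          using fin v(1) by (intro sum_strict_mono_ex1) auto
        \<comment> \<open>The lowered vertex met nobody: nothing is contracted, and the same
          trigraph is treated with smaller levels.\<close>
        then show ?thesis by (intro less.hyps[OF _ plq cq less.prems(3-5)] add_less_le_mono) auto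
      qed
    qed
  qed
qed

section \<open>Levels of a unit ball graph\<close>

definition chain_height :: "'a set \<Rightarrow> ('a \<Rightarrow> real) \<Rightarrow> real \<Rightarrow> ('a \<Rightarrow> nat) \<Rightarrow> bool" where
  "chain_height V x s h \<longleftrightarrow>
     (\<forall>u\<in>V. \<forall>v\<in>V. x u + s \<le> x v \<longrightarrow> h u < h v) \<and>
     (\<forall>v\<in>V. 0 < h v \<longrightarrow> (\<exists>u\<in>V. x u + s \<le> x v \<and> Suc (h u) = h v)) \<and>
     (\<forall>v\<in>V. h v < card V)"

text \<open>Points are inserted in increasing order of \<open>x\<close>. Hence no old point lies a
  step above the new one, and the old heights survive; the new one exceeds the largest height at
  least a step below.\<close>

lemma chain_height_exists:
  assumes "finite V" "0 < s"
  shows "\<exists>h. chain_height V x s h"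
  using assms(1)
proof (induction V rule: finite_ranking_induct[where f = x])
  case empty
  then show ?case by (simp add: chain_height_def)
next
  case (insert v V)
  show ?case
  proof (cases "v \<in> V")
    case True
    then show ?thesis using insert by (simp add: insert_absorb)
  next
    case False
    obtain h where h: "chain_height V x s h" using insert by blast
    define B where "B = {u\<in>V. x u + s \<le> x v}"
    define h' where "h' = h(v := if B = {} then 0 else Suc (Max (h ` B)))"
    have finB: "finite B" using insert by (simp add: B_def)
    have old: "h' u = h u" if "u \<in> V" for u using that False by (auto simp: h'_def)
    have up: "h' u < h' v" if "u \<in> B" for u
    proof -
      have "h u \<le> Max (h ` B)" using that finB by simp
      then show ?thesis using that old[of u] by (auto simp: h'_def B_def)
    qed
    have down: "\<exists>u\<in>B. Suc (h' u) = h' v" if "0 < h' v"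
    proof -
      from that have "B \<noteq> {}" by (auto simp: h'_def)
      then have "Max (h ` B) \<in> h ` B" using finB by (intro Max_in) auto
      then obtain u where "u \<in> B" "h u = Max (h ` B)" by auto
      moreover from this have "u \<in> V" by (simp add: B_def)
      ultimately show ?thesis using old[of u] \<open>B \<noteq> {}\<close> by (intro bexI[of _ u]) (simp_all add: h'_def)
    qed
    have bound: "h' v < card (insert v V)"
    proof (cases "0 < h' v")
      case True
      then obtain u where "u \<in> B" "Suc (h' u) = h' v" using down by blast
      moreover from this have "h' u < card V" using h old by (auto simp: chain_height_def B_def)
      ultimately show ?thesis using False insert by simp
    qed (use insert in \<open>simp add: card_gt_0_iff\<close>)
    have "chain_height (insert v V) x s h'"
      unfolding chain_height_def
    proof (intro conjI ballI impI)
      fix a b assume ab: "a \<in> insert v V" "b \<in> insert v V" "x a + s \<le> x b"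
      have "a \<noteq> v" using ab insert(2)[of b] assms(2) by auto
      show "h' a < h' b"
      proof (cases "b = v")
        case True
        then show ?thesis using ab \<open>a \<noteq> v\<close> up by (auto simp: B_def)
      next
        case False
        then show ?thesis using ab \<open>a \<noteq> v\<close> h by (auto simp: chain_height_def old)
      qed
    next
      fix b assume b: "b \<in> insert v V" "0 < h' b"
      show "\<exists>u\<in>insert v V. x u + s \<le> x b \<and> Suc (h' u) = h' b"
      proof (cases "b = v")
        case True
        then show ?thesis using b down by (auto simp: B_def)
      next
        case False
        then have "b \<in> V" "0 < h b" using b old by auto
        with h obtain u where "u \<in> V" "x u + s \<le> x b" "Suc (h u) = h b"
          unfolding chain_height_def by blast
        then show ?thesis using old \<open>b \<in> V\<close> by (intro bexI[of _ u]) auto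
      qed
    next
      fix b assume "b \<in> insert v V"
      then show "h' b < card (insert v V)"
        using bound h old False insert(1) by (cases "b = v") (auto simp: chain_height_def less_Suc_eq)
    qed
    then show ?thesis by blast
  qed
qed

text \<open>Iterating the second clause of \<open>chain_height\<close> meets every smaller height
  and gains a distance \<open>s\<close> each time.\<close>

lemma chain_height_descend:
  assumes h: "chain_height V x s h" and "v \<in> V" "q \<le> h v"
  shows "\<exists>u\<in>V. h u = q \<and> x u + real (h v - q) * s \<le> x v"
  using assms(2,3)
proof (induction "h v - q" arbitrary: v)
  case 0
  then show ?case by (intro bexI[of _ v]) auto
next
  case (Suc c)
  then have "0 < h v" by linarith
  then obtain u where u: "u \<in> V" "x u + s \<le> x v" "Suc (h u) = h v"
    using h Suc.prems unfolding chain_height_def by blast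
  then have c: "c = h u - q" "q \<le> h u" using Suc by linarith+
  obtain z where z: "z \<in> V" "h z = q" "x z + real (h u - q) * s \<le> x u"
    using Suc.hyps(1)[OF c(1) u(1) c(2)] by blast
  have "real (h v - q) = real (h u - q) + 1" using u(3) c by linarith
  then have "real (h v - q) * s = real (h u - q) * s + s" by (simp add: algebra_simps)
  with u z show ?case by (intro bexI[of _ z]) auto
qed

text \<open>Suppose \<open>h v > h u + m\<close>. A point \<open>z\<close> of height
  \<open>h u + 1\<close> lies at least \<open>h v - h u - 1 \<ge> m\<close> steps below
  \<open>v\<close>. It is strictly above \<open>u\<close>, because its predecessor \<open>y\<close>
  has the same height as \<open>u\<close> and so is not a full step below \<open>u\<close>. This
  strictness turns the count into \<open>h v - h u - 1 < m\<close>.\<close>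

lemma chain_height_lipschitz:
  assumes h: "chain_height V x s h" and uv: "u \<in> V" "v \<in> V"
    and s: "0 < s" and le: "x v \<le> x u + r * s" "r \<le> real m"
  shows "h v \<le> h u + m"
proof (rule ccontr)
  assume "\<not> h v \<le> h u + m"
  then have gt: "h u + m < h v" by simp
  then obtain z where z: "z \<in> V" "h z = Suc (h u)" "x z + real (h v - Suc (h u)) * s \<le> x v"
    using chain_height_descend[OF h uv(2), of "Suc (h u)"] by auto
  obtain y where y: "y \<in> V" "h y = h u" "x y + s \<le> x z"
    using chain_height_descend[OF h z(1), of "h u"] z(2) by auto
  have "\<not> x y + s \<le> x u" using h y(1,2) uv(1) unfolding chain_height_def by (metis less_irrefl)
  then have "x u < x z" using y by simp
  then have "real (h v - Suc (h u)) * s < r * s" using z(3) le by linarith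
  then have "real (h v - Suc (h u)) < real m" using s le(2) by auto
  with gt show False by linarith
qed

lemma chain_height_same:
  assumes "chain_height V x s h" "u \<in> V" "v \<in> V" "h u = h v"
  shows "\<bar>x u - x v\<bar> < s"
proof -
  have "\<not> x u + s \<le> x v" "\<not> x v + s \<le> x u"
    using assms unfolding chain_height_def by (metis less_irrefl)+
  then show ?thesis by linarith
qed

text \<open>Origin of \<open>2 / sqrt d\<close>: a cube of this side has diagonal \<open>2\<close>,
  the largest distance at which unit balls still meet.\<close>

lemma L2_set_le_of_components:
  assumes "\<And>i. i < d \<Longrightarrow> \<bar>f i\<bar> \<le> 2 / sqrt (real d)" "0 < d"
  shows "L2_set f {..<d} \<le> 2"
proof -
  have "(f i)\<^sup>2 \<le> 4 / real d" if "i < d" for i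
  proof -
    have "\<bar>f i\<bar>\<^sup>2 \<le> (2 / sqrt (real d))\<^sup>2"
      using assms(1)[OF that] by (intro power_mono) auto
    then show ?thesis using assms(2) by (simp add: power_divide)
  qed
  then have "(\<Sum>i<d. (f i)\<^sup>2) \<le> (\<Sum>i<d. 4 / real d)" by (intro sum_mono) auto
  also have "\<dots> = 2\<^sup>2" using assms(2) by simp
  finally show ?thesis unfolding L2_set_def by (rule real_le_lsqrt[rotated 1]) simp
qed

lemma fst_ball_graph: "fst (ball_graph d V c) = V"
  by (simp add: ball_graph_def)

text \<open>Interface between geometry and sweep, used for the existence of a sequence and for the
  program alike. The levels take the vertex first, as positions do.\<close>

locale ball_heights =
  fixes d :: nat and V :: "'a set" and c :: "'a \<Rightarrow> nat \<Rightarrow> real" and h :: "'a \<Rightarrow> nat \<Rightarrow> nat"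
  assumes d: "0 < d" and fin: "finite V" and c: "c \<in> V \<rightarrow> topspace (Euclidean_space d)"
    and h: "\<And>j. j < d \<Longrightarrow> chain_height V (\<lambda>v. c v j) (2 / sqrt (real d)) (\<lambda>v. h v j)"
begin

abbreviation G where "G \<equiv> ball_graph d V c"

lemma adjacent_iff:
  assumes "u \<in> V" "v \<in> V" "u \<noteq> v"
  shows "{u, v} \<in> snd G \<longleftrightarrow> L2_set (\<lambda>i. c u i - c v i) {..<d} \<le> 2"
proof -
  have "{u, v} \<in> snd G \<longleftrightarrow> unit_ball d (c u) \<inter> unit_ball d (c v) \<noteq> {}"
    using assms by (auto simp: ball_graph_def doubleton_eq_iff)
  then show ?thesis using unit_balls_meet_iff[of "c u" d "c v"] c assms by (simp add: Pi_iff)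
qed

lemma near_if_adjacent:
  assumes uv: "u \<in> V" "v \<in> V" "u \<noteq> v" "{u, v} \<in> snd G"
  shows "near d (nat \<lceil>sqrt (real d)\<rceil>) h u v"
  unfolding near_def
proof (intro allI impI)
  fix i assume i: "i < d"
  have "\<bar>c u i - c v i\<bar> \<le> L2_set (\<lambda>i. \<bar>c u i - c v i\<bar>) {..<d}"
    using i by (intro member_le_L2_set) auto
  also have "\<dots> = L2_set (\<lambda>i. c u i - c v i) {..<d}" by (simp add: L2_set_def)
  also have "\<dots> \<le> 2" using uv adjacent_iff by blast
  \<comment> \<open>The distance \<open>2\<close> is written as \<open>sqrt d\<close> steps of
    length \<open>2 / sqrt d\<close>, which yields the Lipschitz constant
    \<open>m = \<lceil>sqrt d\<rceil>\<close>.\<close>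
  finally have *: "\<bar>c u i - c v i\<bar> \<le> sqrt (real d) * (2 / sqrt (real d))" using d by simp
  have s: "0 < 2 / sqrt (real d)" using d by simp
  have m: "sqrt (real d) \<le> real (nat \<lceil>sqrt (real d)\<rceil>)" by linarith
  have "c u i \<le> c v i + sqrt (real d) * (2 / sqrt (real d))"
    and "c v i \<le> c u i + sqrt (real d) * (2 / sqrt (real d))"
    using * by linarith+
  then show "h u i \<le> h v i + nat \<lceil>sqrt (real d)\<rceil> \<and> h v i \<le> h u i + nat \<lceil>sqrt (real d)\<rceil>"
    using chain_height_lipschitz[OF h[OF i] uv(1,2) s _ m]
      chain_height_lipschitz[OF h[OF i] uv(2,1) s _ m] by (intro conjI)
qed

lemma adjacent_if_same_cell:
  assumes "u \<in> V" "v \<in> V" "u \<noteq> v" "same_cell d h u v"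
  shows "{u, v} \<in> snd G"
proof -
  have "\<bar>c u i - c v i\<bar> \<le> 2 / sqrt (real d)" if "i < d" for i
    using chain_height_same[OF h[OF that] assms(1,2)] assms(4) that
    by (auto simp: same_cell_def)
  then show ?thesis using adjacent_iff assms d by (simp add: L2_set_le_of_components)
qed

text \<open>The cliques live in \<open>G\<close>, not in its subgraph \<open>H\<close>; this is why
  the clique number of \<open>G\<close> governs every subgraph.\<close>

lemma cells_le_clique_number:
  assumes "A \<subseteq> V"
  shows "cells_le d (clique_number G) h A"
  unfolding cells_le_def
proof
  fix x assume x: "x \<in> A"
  let ?C = "{y \<in> A. same_cell d h y x}"
  have "clique G ?C"
    unfolding clique_def
  proof (intro conjI ballI impI)
    show "?C \<subseteq> fst G" using assms by (auto simp: fst_ball_graph)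
  next
    fix u v assume "u \<in> ?C" "v \<in> ?C" "u \<noteq> v"
    then show "{u, v} \<in> snd G"
      using assms by (intro adjacent_if_same_cell) (auto simp: same_cell_def)
  qed
  moreover have "finite {C. clique G C}"
  proof (rule finite_subset)
    show "{C. clique G C} \<subseteq> Pow V" by (rule subsetI) (simp add: clique_def fst_ball_graph)
  qed (simp add: fin)
  ultimately show "card ?C \<le> clique_number G"
    unfolding clique_number_def by (intro Max_ge finite_imageI imageI) simp_all
qed

lemma placed_subgraph:
  assumes "subgraph H G"
  shows "placed d (nat \<lceil>sqrt (real d)\<rceil>) h (trigraph_of H)"
proof -
  have *: "fst H \<subseteq> V" "snd H \<subseteq> snd G" "simple_graph H" 
    using assms by (simp_all add: subgraph_def fst_ball_graph)
  have "\<exists>x\<in>fst H. \<exists>y\<in>fst H. x \<noteq> y \<and> e = {x, y} \<and> near d (nat \<lceil>sqrt (real d)\<rceil>) h x y"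
    if "e \<in> snd H" for e
  proof -
    have "e \<in> {{u, v} | u v. u \<in> fst H \<and> v \<in> fst H \<and> u \<noteq> v}"
      using *(3) that unfolding simple_graph_def by (meson subsetD)
    then obtain x y where xy: "x \<in> fst H" "y \<in> fst H" "x \<noteq> y" "e = {x, y}" by (elim CollectE exE conjE)
    then have "near d (nat \<lceil>sqrt (real d)\<rceil>) h x y"
      using * that by (intro near_if_adjacent) auto
    with xy show ?thesis by (intro bexI[of _ x] bexI[of _ y] conjI)
  qed
  then show ?thesis using *(3) by (simp add: placed_def trigraph_of_def simple_graph_def)
qed

end

lemma twin_width_subgraph_ball_graph_le:
  assumes d: "0 < d" and fin: "finite V" and c: "c \<in> V \<rightarrow> topspace (Euclidean_space d)"
    and k: "0 < clique_number (ball_graph d V c)"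
    and H: "subgraph H (ball_graph d V c)" "fst H \<noteq> {}"
  shows "twin_width H \<le> width_bound d (clique_number (ball_graph d V c))"
proof -
  define hs where "hs j = (SOME h. chain_height V (\<lambda>v. c v j) (2 / sqrt (real d)) h)" for j
  have "0 < 2 / sqrt (real d)" using d by simp
  then have "chain_height V (\<lambda>v. c v j) (2 / sqrt (real d)) (hs j)" for j
    unfolding hs_def by (intro someI_ex[where P = "chain_height V _ _"] chain_height_exists[OF fin])
  then interpret ball_heights d V c "\<lambda>v j. hs j v"
    using d fin c by unfold_locales
  let ?m = "nat \<lceil>sqrt (real d)\<rceil>"
  have m: "1 \<le> ?m" using d by (simp add: Suc_le_eq)
  have "fst H \<subseteq> V" using H by (simp add: subgraph_def fst_ball_graph)
  then have cells: "cells_le d (clique_number G) (\<lambda>v j. hs j v) (verts (trigraph_of H))"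
    by (simp add: trigraph_of_def cells_le_clique_number)
  have "verts (trigraph_of H) \<noteq> {}" using H by (simp add: trigraph_of_def)
  from contraction_sequence_exists[OF placed_subgraph[OF H(1)] cells this m k]
  show ?thesis unfolding twin_width_def width_bound_def by (rule Least_le)
qed

section \<open>Programs with bounded loops\<close>

text \<open>Common ground of bit length and unit cost. The factor in \<open>w_add\<close> pays for
  adding fractions, where the denominators enter numerator and denominator. The linear bound for
  naturals is crude but enough, as only numbers linear in the input size are ever stored besides the
  input itself.\<close>

locale cost_model =
  fixes w :: "'a::linordered_field \<Rightarrow> nat"
  assumes w_pos: "1 \<le> w x"
    and w_of_nat: "w (of_nat n) \<le> n + 2"
    and w_uminus: "w (- x) = w x"
    and w_add: "w (x + y) \<le> 2 * (w x + w y)"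
    and w_mult: "w (x * y) \<le> w x + w y"
    and w_divide: "w (x / y) \<le> w x + w y"
begin

lemma w_diff: "w (x - y) \<le> 2 * (w x + w y)"
  using w_add[of x "- y"] w_uminus[of y] by simp

lemma w_of_int: "w (of_int z) \<le> nat \<bar>z\<bar> + 2"
proof (cases z)
  case (nonneg n)
  then show ?thesis using w_of_nat[of n] by simp
next
  case (neg n)
  then have "of_int z = - (of_nat (Suc n) :: 'a)" by simp
  then show ?thesis using w_of_nat[of "Suc n"] neg by (simp only: w_uminus)
qed

end

section \<open>Running time read off the program text\<close>

fun val_weight :: "exp \<Rightarrow> nat" where
  "val_weight (Const z) = nat \<bar>z\<bar> + 2"
| "val_weight (Rd a e) = 1"
| "val_weight (Add e f) = 2 * (val_weight e + val_weight f)"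
| "val_weight (Sub e f) = 2 * (val_weight e + val_weight f)"
| "val_weight (Mul e f) = val_weight e + val_weight f"
| "val_weight (Div e f) = val_weight e + val_weight f"

fun exp_cost :: "exp \<Rightarrow> nat" where
  "exp_cost (Const z) = nat \<bar>z\<bar> + 2"
| "exp_cost (Rd a e) = exp_cost e + 1"
| "exp_cost (Add e f) = exp_cost e + exp_cost f + 2 * (val_weight e + val_weight f)"
| "exp_cost (Sub e f) = exp_cost e + exp_cost f + 2 * (val_weight e + val_weight f)"
| "exp_cost (Mul e f) = exp_cost e + exp_cost f + val_weight e + val_weight f"
| "exp_cost (Div e f) = exp_cost e + exp_cost f + val_weight e + val_weight f"

fun test_cost :: "cnd \<Rightarrow> nat" where
  "test_cost (Less e f) = exp_cost e + exp_cost f + 1"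
| "test_cost (Neg b) = test_cost b + 1"
| "test_cost (Conj b b') = test_cost b + test_cost b' + 1"

text \<open>A bound on the running time that depends on the program text only, provided that no loop takes
  more than \<open>N\<close> rounds and that all memory cells have weight at most \<open>W\<close> throughout.\<close>

fun time_bound :: "nat \<Rightarrow> nat \<Rightarrow> com \<Rightarrow> nat" where
  "time_bound N W Skip = 1"
| "time_bound N W (Write a e f) = (exp_cost e + exp_cost f) * W + 1"
| "time_bound N W (Seq c c') = time_bound N W c + time_bound N W c' + 1"
| "time_bound N W (Cond b c c') = test_cost b * W + time_bound N W c + time_bound N W c' + 1"
| "time_bound N W (While b c) = (N + 1) * (test_cost b * W + time_bound N W c + 1)"

text \<open>For a fixed program the bound is a polynomial in \<open>N\<close> and \<open>W\<close>
  whose degree depends on the nesting of loops only.\<close>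

lemma time_bound_poly: "\<exists>p. \<forall>x. poly p x = time_bound (poly P x) (poly Q x) c"
proof (induction c)
  case Skip
  show ?case by (rule exI[of _ "[:1:]"]) simp
next
  case (Write a e f)
  show ?case by (rule exI[of _ "[:exp_cost e + exp_cost f:] * Q + [:1:]"]) simp
next
  case (Seq c c')
  then obtain p p' where "\<And>x. poly p x = time_bound (poly P x) (poly Q x) c"
    "\<And>x. poly p' x = time_bound (poly P x) (poly Q x) c'" by blast
  then show ?case by (intro exI[of _ "p + p' + [:1:]"]) simp
next
  case (Cond b c c')
  then obtain p p' where "\<And>x. poly p x = time_bound (poly P x) (poly Q x) c"
    "\<And>x. poly p' x = time_bound (poly P x) (poly Q x) c'" by blast
  then show ?case by (intro exI[of _ "[:test_cost b:] * Q + p + p' + [:1:]"]) simp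
next
  case (While b c)
  then obtain p where "\<And>x. poly p x = time_bound (poly P x) (poly Q x) c" by blast
  then show ?case
    by (intro exI[of _ "(P + [:1:]) * ([:test_cost b:] * Q + p + [:1:])"]) (simp add: algebra_simps)
qed

definition For :: "nat \<Rightarrow> exp \<Rightarrow> com \<Rightarrow> com" where
  "For i e c = Seq (Write i (Const 0) (Const 0))
     (While (Less (Rd i (Const 0)) e) (Seq c (Write i (Const 0) (Add (Rd i (Const 0)) (Const 1)))))"

locale bounded_cost = cost_model w for w :: "'a::linordered_field \<Rightarrow> nat" +
  fixes N W :: nat
begin

definition light :: "'a store \<Rightarrow> bool" where
  "light s \<longleftrightarrow> (\<forall>a i. w (s a i) \<le> W)"

text \<open>Total correctness in weakest-precondition style. Time and weight never appear in
  \<open>Q\<close>: the time depends on the program text, and \<open>light\<close> is a tacit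
  invariant of all executions.\<close>

definition runs :: "com \<Rightarrow> 'a store \<Rightarrow> ('a store \<Rightarrow> bool) \<Rightarrow> bool" where
  "runs c s Q \<longleftrightarrow> (light s \<longrightarrow> (\<exists>t s'. exec w c s t s' \<and> t \<le> time_bound N W c \<and> light s' \<and> Q s'))"

lemma w_val_le:
  assumes "light s"
  shows "w (val e s) \<le> val_weight e * W"
proof (induction e)
  case (Const z)
  have "nat \<bar>z\<bar> + 2 \<le> (nat \<bar>z\<bar> + 2) * W"
    using assms w_pos[of "s 0 0"] unfolding light_def by (metis Nat.le_trans mult.right_neutral mult_le_mono2)
  then show ?case using w_of_int[of z] unfolding val.simps val_weight.simps by (rule order_trans[rotated])
next
  case (Rd a e)
  show ?case using assms by (simp add: light_def)
next
  case (Add e f)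
  then show ?case using w_add[of "val e s" "val f s"] by (simp add: algebra_simps)
next
  case (Sub e f)
  then show ?case using w_diff[of "val e s" "val f s"] by (simp add: algebra_simps)
next
  case (Mul e f)
  then show ?case using w_mult[of "val e s" "val f s"] by (simp add: algebra_simps)
next
  case (Div e f)
  then show ?case using w_divide[of "val e s" "val f s"] by (simp add: algebra_simps)
qed

lemma cost_le:
  assumes "light s"
  shows "cost w e s \<le> exp_cost e * W"
proof (induction e)
  case (Const z)
  show ?case using w_val_le[OF assms, of "Const z"] by simp
next
  case (Rd a e)
  then show ?case using w_val_le[OF assms, of "Rd a e"] by (simp add: algebra_simps)
next
  case (Add e f)
  then show ?case using w_val_le[OF assms, of "Add e f"] by (simp add: algebra_simps)
next
  case (Sub e f)
  then show ?case using w_val_le[OF assms, of "Sub e f"] by (simp add: algebra_simps)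
next
  case (Mul e f)
  then show ?case using w_val_le[OF assms, of "Mul e f"] by (simp add: algebra_simps)
next
  case (Div e f)
  then show ?case using w_val_le[OF assms, of "Div e f"] by (simp add: algebra_simps)
qed

lemma cost_cnd_le:
  assumes "light s"
  shows "cost_cnd w b s \<le> test_cost b * W"
proof -
  have W: "1 \<le> W" using assms w_pos[of "s 0 0"] unfolding light_def by (meson order_trans)
  show ?thesis
  proof (induction b)
    case (Less e f)
    then show ?case using cost_le[OF assms, of e] cost_le[OF assms, of f] W by (simp add: algebra_simps)
  qed (use W in \<open>simp_all add: algebra_simps\<close>)
qed

lemma runs_consequence: "runs c s Q \<Longrightarrow> (\<And>s'. Q s' \<Longrightarrow> Q' s') \<Longrightarrow> runs c s Q'"
  unfolding runs_def by blast

lemma runs_Skip: "Q s \<Longrightarrow> runs Skip s Q"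
  unfolding runs_def using exec.Skip by fastforce

text \<open>The only rule with an obligation about weights, since only writing can create a heavy
  cell.\<close>

lemma runs_Write:
  assumes "light s \<Longrightarrow> w (val f s) \<le> W" "Q (s(a := (s a)(val e s := val f s)))"
  shows "runs (Write a e f) s Q"
  unfolding runs_def
proof
  assume l: "light s"
  have "light (s(a := (s a)(val e s := val f s)))" using l assms(1) by (simp add: light_def)
  moreover have "cost w e s + cost w f s + 1 \<le> time_bound N W (Write a e f)"
    using cost_le[OF l, of e] cost_le[OF l, of f] by (simp add: algebra_simps)
  ultimately show "\<exists>t s'. exec w (Write a e f) s t s' \<and> t \<le> time_bound N W (Write a e f) \<and> light s' \<and> Q s'"
    using exec.Write assms(2) by blast
qed

lemma runs_Seq: "runs c s (\<lambda>s'. runs c' s' Q) \<Longrightarrow> runs (Seq c c') s Q"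
  unfolding runs_def
  by (smt (verit, ccfv_threshold) add_mono_thms_linordered_semiring(1,3) exec.Seq time_bound.simps(3))

lemma runs_Cond:
  assumes "holds b s \<Longrightarrow> runs c s Q" "\<not> holds b s \<Longrightarrow> runs c' s Q"
  shows "runs (Cond b c c') s Q"
  unfolding runs_def
proof
  assume l: "light s"
  note b = cost_cnd_le[OF l, of b]
  show "\<exists>t s'. exec w (Cond b c c') s t s' \<and> t \<le> time_bound N W (Cond b c c') \<and> light s' \<and> Q s'"
  proof (cases "holds b s")
    case True
    then obtain t s' where "exec w c s t s'" "t \<le> time_bound N W c" "light s'" "Q s'"
      using assms l unfolding runs_def by blast
    with b True show ?thesis
      by (intro exI[of _ "cost_cnd w b s + t + 1"] exI[of _ s']) (auto intro: exec.CondTrue simp del: One_nat_def add_Suc_right add_Suc)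
  next
    case False
    then obtain t s' where "exec w c' s t s'" "t \<le> time_bound N W c'" "light s'" "Q s'"
      using assms l unfolding runs_def by blast
    with b False show ?thesis
      by (intro exI[of _ "cost_cnd w b s + t + 1"] exI[of _ s']) (auto intro: exec.CondFalse simp del: One_nat_def add_Suc_right add_Suc)
  qed
qed

lemma runs_While:
  assumes "n \<le> N"
    and test: "\<And>k s. k \<le> n \<Longrightarrow> I k s \<Longrightarrow> holds b s \<longleftrightarrow> k < n"
    and body: "\<And>k s. k < n \<Longrightarrow> I k s \<Longrightarrow> runs c s (I (Suc k))"
    and init: "I 0 s"
  shows "runs (While b c) s (I n)"
  unfolding runs_def
proof
  assume l: "light s"
  define B where "B = test_cost b * W + time_bound N W c + 1"
  \<comment> \<open>\<open>B\<close> pays for one test and one round; the additional summand in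
    \<open>Suc (n - k)\<close> pays for the final failing test.\<close>
  have "\<exists>t s'. exec w (While b c) s t s' \<and> t \<le> (Suc (n - k)) * B \<and> light s' \<and> I n s'"
    if "k \<le> n" "I k s" "light s" for k s
    using that
  proof (induction "n - k" arbitrary: k s)
    case 0
    then have "\<not> holds b s" "k = n" using test[of k s] by auto
    then have "exec w (While b c) s (cost_cnd w b s + 1) s" by (intro exec.WhileFalse)
    moreover have "cost_cnd w b s + 1 \<le> B"
      using cost_cnd_le[OF \<open>light s\<close>, of b] by (simp add: B_def)
    ultimately show ?case using 0 \<open>k = n\<close> by auto
  next
    case (Suc r)
    then have k: "k < n" "holds b s" using test[of k s] by auto
    obtain t s1 where s1: "exec w c s t s1" "t \<le> time_bound N W c" "light s1" "I (Suc k) s1"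
      using body[OF k(1) Suc.prems(2)] Suc.prems(3) unfolding runs_def by blast
    have "r = n - Suc k" using Suc.hyps(2) by linarith
    then obtain t' s2 where s2: "exec w (While b c) s1 t' s2" "t' \<le> Suc (n - Suc k) * B" "light s2" "I n s2"
      using Suc.hyps(1)[of "Suc k" s1] k(1) s1 by auto
    have "cost_cnd w b s + t + 1 \<le> B"
      using cost_cnd_le[OF Suc.prems(3), of b] s1(2) by (simp add: B_def)
    moreover have "Suc (n - k) * B = B + Suc (n - Suc k) * B" using k(1) by (simp add: Suc_diff_Suc[symmetric])
    ultimately have "cost_cnd w b s + t + t' + 1 \<le> Suc (n - k) * B" using s2(2) by linarith
    then show ?case using exec.WhileTrue[OF k(2) s1(1) s2(1)] s2 by blast
  qed
  from this[of 0 s] init l obtain t s' where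
    t: "exec w (While b c) s t s'" "t \<le> Suc n * B" "light s'" "I n s'" by auto
  moreover have "Suc n * B \<le> time_bound N W (While b c)"
    unfolding time_bound.simps B_def using assms(1) by (intro mult_right_mono) auto
  ultimately show "\<exists>t s'. exec w (While b c) s t s' \<and> t \<le> time_bound N W (While b c) \<and> light s' \<and> I n s'"
    using order_trans by blast
qed

text \<open>The bound \<open>e\<close> is evaluated anew in each round, so the invariant has to fix
  its value. The body must leave the counter alone; its increment is written into the postcondition
  of the body.\<close>

lemma runs_For:
  assumes n: "n \<le> N" "n + 2 \<le> W"
    and inv: "\<And>k s. k \<le> n \<Longrightarrow> I k s \<Longrightarrow> s i 0 = of_nat k \<and> val e s = of_nat n"
    and init: "I 0 (s(i := (s i)(0 := 0)))"
    and body: "\<And>k s. k < n \<Longrightarrow> I k s \<Longrightarrow>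
      runs c s (\<lambda>s'. s' i 0 = of_nat k \<and> I (Suc k) (s'(i := (s' i)(0 := of_nat (Suc k)))))"
    and final: "\<And>s. I n s \<Longrightarrow> Q s"
  shows "runs (For i e c) s Q"
  unfolding For_def
proof (intro runs_Seq runs_Write)
  show "w (val (Const 0) s) \<le> W" using w_of_nat[of 0] n by simp
  let ?inc = "Write i (Const 0) (Add (Rd i (Const 0)) (Const 1))"
  let ?s = "s(i := (s i)(val (Const 0) s := val (Const 0) s))"
  have "runs (While (Less (Rd i (Const 0)) e) (Seq c ?inc)) ?s (I n)"
  proof (rule runs_While[OF n(1)])
    show "I 0 ?s" using init by simp
  next
    fix k s assume "k \<le> n" "I k s"
    then show "holds (Less (Rd i (Const 0)) e) s \<longleftrightarrow> k < n" using inv[of k s] by simp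
  next
    fix k s assume k: "k < n" "I k s"
    have "runs ?inc s' (I (Suc k))"
      if "s' i 0 = of_nat k" "I (Suc k) (s'(i := (s' i)(0 := of_nat (Suc k))))" for s'
    proof (rule runs_Write)
      show "w (val (Add (Rd i (Const 0)) (Const 1)) s') \<le> W"
        using w_of_nat[of "Suc k"] k n that by (simp add: add.commute)
      show "I (Suc k) (s'(i := (s' i)(val (Const 0) s' := val (Add (Rd i (Const 0)) (Const 1)) s')))"
        using that by (simp add: add.commute)
    qed
    then show "runs (Seq c ?inc) s (I (Suc k))"
      by (intro runs_Seq runs_consequence[OF body[OF k]]) blast
  qed
  then show "runs (While (Less (Rd i (Const 0)) e) (Seq c ?inc)) ?s Q"
    by (rule runs_consequence) (rule final)
qed

end

section \<open>Cost measures\<close>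

lemma floorlog_mult_le: "floorlog 2 (x * y) \<le> floorlog 2 x + floorlog 2 y"
proof (rule floorlog_leI)
  have "x < 2 ^ floorlog 2 x" "y < 2 ^ floorlog 2 y" by (auto intro: floorlog_leD)
  then show "x * y < 2 ^ (floorlog 2 x + floorlog 2 y)"
    by (simp add: power_add mult_strict_mono')
qed auto

lemma floorlog_add_le: "floorlog 2 (x + y) \<le> floorlog 2 x + floorlog 2 y + 1"
proof (rule floorlog_leI)
  let ?m = "floorlog 2 x + floorlog 2 y"
  have "x < 2 ^ ?m" "y < 2 ^ ?m" by (auto intro: floorlog_leD)
  then show "x + y < 2 ^ (?m + 1)" by simp
qed auto

text \<open>Any representation of \<open>q\<close> is a positive multiple of the reduced one, so its
  numerator and denominator are at least as large in absolute value.\<close>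

lemma bit_size_fraction_le:
  assumes b: "0 < b" and q: "q = of_int a / of_int b"
  shows "bit_size q \<le> 1 + floorlog 2 (nat \<bar>a\<bar>) + floorlog 2 (nat b)"
proof -
  obtain p r where pr: "quotient_of q = (p, r)" by fastforce
  have r: "0 < r" and cop: "coprime p r" and q': "q = of_int p / of_int r"
    using quotient_of_denom_pos[OF pr] quotient_of_coprime[OF pr] quotient_of_div[OF pr] by auto
  have "(of_int a :: rat) * of_int r = of_int p * of_int b"
    using q q' b r by (simp add: field_simps)
  then have eq: "a * r = p * b" by (metis of_int_eq_iff of_int_mult)
  then have "r dvd p * b" by (metis dvd_triv_right)
  then have "r dvd b" using cop by (simp add: coprime_commute coprime_dvd_mult_right_iff)
  then obtain c where c: "b = r * c" by blast
  then have c0: "0 < c" using b r by (simp add: zero_less_mult_iff)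
  have "a = p * c" using eq c r by simp
  then have "\<bar>p\<bar> \<le> \<bar>a\<bar>" using c0 by (simp add: abs_mult mult_le_cancel_left1)
  moreover have "r \<le> b" using c c0 r by (simp add: mult_le_cancel_left1)
  ultimately have "floorlog 2 (nat \<bar>p\<bar>) \<le> floorlog 2 (nat \<bar>a\<bar>)" "floorlog 2 (nat r) \<le> floorlog 2 (nat b)"
    by (auto intro!: floorlog_mono nat_mono)
  then show ?thesis by (simp add: bit_size_def pr)
qed

lemma bit_size_eq:
  obtains a b where "0 < b" "x = of_int a / of_int b"
    "bit_size x = 1 + floorlog 2 (nat \<bar>a\<bar>) + floorlog 2 (nat b)"
proof -
  obtain a b where ab: "quotient_of x = (a, b)" by fastforce
  have "bit_size x = 1 + floorlog 2 (nat \<bar>a\<bar>) + floorlog 2 (nat b)"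
    by (simp add: bit_size_def ab)
  from that[OF quotient_of_denom_pos[OF ab] quotient_of_div[OF ab] this] show ?thesis .
qed

lemma bit_size_mult_le: "bit_size (x * y) \<le> bit_size x + bit_size y"
proof -
  obtain a b where ab: "0 < b" "x = of_int a / of_int b"
    "bit_size x = 1 + floorlog 2 (nat \<bar>a\<bar>) + floorlog 2 (nat b)" by (rule bit_size_eq)
  obtain c d where cd: "0 < d" "y = of_int c / of_int d"
    "bit_size y = 1 + floorlog 2 (nat \<bar>c\<bar>) + floorlog 2 (nat d)" by (rule bit_size_eq)
  have "bit_size (x * y) \<le> 1 + floorlog 2 (nat \<bar>a * c\<bar>) + floorlog 2 (nat (b * d))"
    using ab cd by (intro bit_size_fraction_le) auto
  also have "\<dots> \<le> bit_size x + bit_size y"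
    using floorlog_mult_le[of "nat \<bar>a\<bar>" "nat \<bar>c\<bar>"] floorlog_mult_le[of "nat b" "nat d"] ab cd
    by (simp add: abs_mult nat_mult_distrib)
  finally show ?thesis .
qed

lemma bit_size_inverse: "bit_size (inverse x) \<le> bit_size x"
proof (cases "x = 0")
  case False
  obtain a b where ab: "0 < b" "x = of_int a / of_int b"
    "bit_size x = 1 + floorlog 2 (nat \<bar>a\<bar>) + floorlog 2 (nat b)" by (rule bit_size_eq)
  then have "a \<noteq> 0" using False by auto
  \<comment> \<open>The sign of \<open>a\<close> moves to the new numerator, as denominators have to
    be positive.\<close>
  have "bit_size (inverse x) \<le> 1 + floorlog 2 (nat \<bar>sgn a * b\<bar>) + floorlog 2 (nat \<bar>a\<bar>)"
    unfolding ab(2) using \<open>a \<noteq> 0\<close> ab(1)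
    by (intro bit_size_fraction_le) (auto simp: field_simps sgn_if abs_if)
  then show ?thesis using ab \<open>a \<noteq> 0\<close> by (simp add: abs_mult)
qed simp

lemma bit_size_uminus: "bit_size (- x) = bit_size x"
  by (simp add: bit_size_def rat_uminus_code split: prod.split)

lemma bit_size_add_le: "bit_size (x + y) \<le> 2 * (bit_size x + bit_size y)"
proof -
  obtain a b where ab: "0 < b" "x = of_int a / of_int b"
    "bit_size x = 1 + floorlog 2 (nat \<bar>a\<bar>) + floorlog 2 (nat b)" by (rule bit_size_eq)
  obtain c d where cd: "0 < d" "y = of_int c / of_int d"
    "bit_size y = 1 + floorlog 2 (nat \<bar>c\<bar>) + floorlog 2 (nat d)" by (rule bit_size_eq)
  have xy: "bit_size (x + y) \<le> 1 + floorlog 2 (nat \<bar>a * d + c * b\<bar>) + floorlog 2 (nat (b * d))"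
    using ab cd by (intro bit_size_fraction_le) (auto simp: field_simps)
  have bd: "nat (b * d) = nat b * nat d" using ab(1) by (simp add: nat_mult_distrib)
  have sum: "floorlog 2 (nat \<bar>a * d + c * b\<bar>) \<le> floorlog 2 (nat \<bar>a\<bar> * nat d + nat \<bar>c\<bar> * nat b)"
  proof (rule floorlog_mono)
    have "\<bar>a * d + c * b\<bar> \<le> \<bar>a\<bar> * d + \<bar>c\<bar> * b"
      using abs_triangle_ineq[of "a * d" "c * b"] ab(1) cd(1) by (simp add: abs_mult)
    then show "nat \<bar>a * d + c * b\<bar> \<le> nat \<bar>a\<bar> * nat d + nat \<bar>c\<bar> * nat b"
      using ab(1) cd(1) by (simp add: nat_le_iff)
  qed
  \<comment> \<open>In \<open>(a * d + c * b) / (b * d)\<close> each of the four logarithms occurs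
    at most twice, whence the factor \<open>2\<close>; the constants leave room for the
    carry.\<close>
  have arith: "B \<le> 2 * (X + Y)"
    if "B \<le> 1 + F + G" "F \<le> H" "H \<le> P + Q + 1" "P \<le> la + ld" "Q \<le> lc + lb" "G \<le> lb + ld"
      "X = 1 + la + lb" "Y = 1 + lc + ld" for B X Y F G H P Q la lb lc ld :: nat
    using that by simp
  show ?thesis
    by (rule arith[OF xy[unfolded bd] sum floorlog_add_le floorlog_mult_le floorlog_mult_le
          floorlog_mult_le ab(3) cd(3)])
qed

lemma floorlog_le_self: "floorlog 2 n \<le> n"
  by (rule floorlog_leI) (auto intro: less_exp)

lemma cost_model_bit_size: "cost_model bit_size"
proof
  show "1 \<le> bit_size x" for x by (simp add: bit_size_def split: prod.split)
  show "bit_size (of_nat n) \<le> n + 2" for n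
  proof -
    have "floorlog 2 1 \<le> 1" by (rule floorlog_le_self)
    then show ?thesis
      using bit_size_fraction_le[of 1 "of_nat n" "int n"] floorlog_le_self[of n] by simp
  qed
  show "bit_size (x / y) \<le> bit_size x + bit_size y" for x y
    using bit_size_mult_le[of x "inverse y"] bit_size_inverse[of y] by (simp add: divide_inverse)
qed (rule bit_size_uminus bit_size_add_le bit_size_mult_le)+

lemma cost_model_unit_size: "cost_model unit_size"
  by unfold_locales (simp_all add: unit_size_def)

section \<open>The contraction program\<close>

abbreviation (input) cell0 :: "nat \<Rightarrow> exp" where "cell0 a \<equiv> Rd a (Const 0)"
text \<open>Cell 0 of array 0 holds the length of the input list, so everything is shifted by one:
  \<open>d\<close> and the number of balls come next, the coordinates start at 3.\<close>

abbreviation (input) dim :: exp where "dim \<equiv> Rd 0 (Const 1)"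
abbreviation (input) num :: exp where "num \<equiv> Rd 0 (Const 2)"
abbreviation (input) index :: "exp \<Rightarrow> exp \<Rightarrow> exp" where "index v i \<equiv> Add (Mul v dim) i"
abbreviation (input) coord :: "exp \<Rightarrow> exp \<Rightarrow> exp" where "coord v i \<equiv> Rd 0 (Add (Const 3) (index v i))"
abbreviation (input) level :: "exp \<Rightarrow> exp \<Rightarrow> exp" where "level v i \<equiv> Rd 2 (index v i)"
abbreviation (input) Equal :: "exp \<Rightarrow> exp \<Rightarrow> cnd" where
  "Equal e f \<equiv> Conj (Neg (Less e f)) (Neg (Less f e))"

definition push :: "exp \<Rightarrow> com" where
  "push e = Seq (Write 1 (Add (cell0 1) (Const 1)) e) (Write 1 (Const 0) (Add (cell0 1) (Const 1)))"

text \<open>Memory layout: array 1 is the output; array 2 holds the current cells, row by row; array 3 marks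
  the vertices that are still present. Arrays 4 to 8 hold the loop counters \<open>j\<close>, \<open>r\<close>, \<open>v\<close>, \<open>u\<close>, \<open>i\<close>, and
  array 9 a flag.\<close>

definition mark_vertices :: com where
  "mark_vertices = For 4 (Rd 0 (Add (Const 3) (Mul num dim)))
     (Write 3 (Rd 0 (Add (Const 4) (Add (Mul num dim) (cell0 4)))) (Const 1))"

text \<open>Longest chains by relaxation: in round \<open>r\<close>, a vertex that lies at least a
  step above some vertex of current level \<open>r\<close> receives level \<open>r + 1\<close>. The
  step \<open>2 / sqrt d\<close> is tested in squared form, as the machine has no square
  root.\<close>

definition compute_levels :: com where
  "compute_levels = For 4 dim (For 5 num (For 6 num (For 7 num
     (Cond (Conj (Less (coord (cell0 7) (cell0 4)) (coord (cell0 6) (cell0 4)))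
             (Conj (Neg (Less (Mul (Mul (Sub (coord (cell0 6) (cell0 4)) (coord (cell0 7) (cell0 4)))
                                        (Sub (coord (cell0 6) (cell0 4)) (coord (cell0 7) (cell0 4)))) dim) (Const 4)))
               (Equal (level (cell0 7) (cell0 4)) (cell0 5))))
        (Write 2 (index (cell0 6) (cell0 4)) (Add (cell0 5) (Const 1)))
        Skip))))"

definition compare_cells :: com where
  "compare_cells = Seq (Write 9 (Const 0) (Const 1))
     (For 8 dim (Cond (Equal (level (cell0 7) (cell0 8)) (level (cell0 6) (cell0 8)))
        Skip (Write 9 (Const 0) (Const 0))))"

text \<open>The vertex \<open>v\<close> is merged into the first suitable \<open>u\<close> and then
  unmarked, so the test fails for all later \<open>u\<close>: at most one contraction per
  call.\<close>

definition merge_vertex :: com where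
  "merge_vertex = For 7 num (Seq compare_cells
     (Cond (Conj (Less (Const 0) (Rd 3 (cell0 7))) (Conj (Less (Const 0) (Rd 3 (cell0 6)))
              (Conj (Neg (Equal (cell0 7) (cell0 6))) (Less (Const 0) (cell0 9)))))
        (Seq (push (cell0 7)) (Seq (push (cell0 6)) (Seq (push (cell0 7)) (Write 3 (cell0 6) (Const 0)))))
        Skip))"

text \<open>Before pass \<open>l\<close> the remaining vertices have level at most
  \<open>n - l\<close>, so the equality test selects vertices of maximal level. Each is lowered and
  merged before the next one is looked at.\<close>

definition sweep_levels :: com where
  "sweep_levels = For 4 dim (For 5 num (For 6 num (Seq
     (Cond (Equal (Add (level (cell0 6) (cell0 4)) (cell0 5)) num)
        (Write 2 (index (cell0 6) (cell0 4)) (Sub (level (cell0 6) (cell0 4)) (Const 1)))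
        Skip)
     merge_vertex)))"

definition contraction_program :: com where
  "contraction_program = Seq mark_vertices (Seq compute_levels sweep_levels)"

section \<open>What the program does to its memory\<close>

lemma index_eq_iff:
  assumes "i < d" "i' < d"
  shows "of_nat v * of_nat d + of_nat i = (of_nat v' * of_nat d + of_nat i' :: 'a::linordered_field) \<longleftrightarrow>
    v = v' \<and> i = i'"
proof
  assume "of_nat v * of_nat d + of_nat i = (of_nat v' * of_nat d + of_nat i' :: 'a)"
  then have "(of_nat (v * d + i) :: 'a) = of_nat (v' * d + i')" by simp
  then have eq: "v * d + i = v' * d + i'" by (simp only: of_nat_eq_iff)
  then have "(v * d + i) div d = (v' * d + i') div d" "(v * d + i) mod d = (v' * d + i') mod d" by simp_all
  with assms show "v = v' \<and> i = i'" by simp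
qed simp

lemma holds_list_snoc:
  assumes "holds_list s a xs"
  shows "holds_list (s(a := (s a)(of_nat (length xs) + 1 := x, 0 := of_nat (length xs) + 1))) a (xs @ [x])"
proof -
  have len: "of_nat (length xs) + 1 = (of_nat (Suc (length xs)) :: 'a)" by simp
  have "(of_nat (Suc i) :: 'a) \<noteq> 0" for i by (simp only: of_nat_eq_0_iff)
  then show ?thesis
    using assms unfolding holds_list_def len
    by (auto simp: nth_append less_Suc_eq simp del: of_nat_Suc)
qed

text \<open>The largest number written is the length of the output, at most three entries for each
  of at most \<open>n\<close> contractions; this explains \<open>3 * n + 2 \<le> W\<close>.\<close>

locale program_run = bounded_cost w N W
  for w :: "'a::linordered_field \<Rightarrow> nat" and N W +
  fixes d n :: nat and inp :: "'a \<Rightarrow> 'a" and X :: "nat \<Rightarrow> nat \<Rightarrow> 'a" and vs :: "nat list"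
  assumes inp_dim: "inp 1 = of_nat d" and inp_num: "inp 2 = of_nat n"
    and inp_coord: "\<And>v i. v < n \<Longrightarrow> i < d \<Longrightarrow> inp (3 + (of_nat v * of_nat d + of_nat i)) = X v i"
    and inp_length: "inp (3 + of_nat n * of_nat d) = of_nat (length vs)"
    and inp_vertex: "\<And>i. i < length vs \<Longrightarrow> inp (4 + (of_nat n * of_nat d + of_nat i)) = of_nat (vs ! i)"
    and vs: "distinct vs" "set vs \<subseteq> {..<n}"
    and bounds: "d \<le> N" "n \<le> N" "d + 2 \<le> W" "3 * n + 2 \<le> W"
begin

text \<open>The current trigraph is not stored: it is determined by \<open>H\<close> and the
  contractions \<open>cs\<close> made so far.\<close>

definition config :: "'a store \<Rightarrow> (nat \<Rightarrow> nat \<Rightarrow> nat) \<Rightarrow> nat set \<Rightarrow> (nat \<times> nat \<times> nat) list \<Rightarrow> bool" where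
  "config s p A cs \<longleftrightarrow> s 0 = inp \<and>
     (\<forall>v<n. \<forall>i<d. s 2 (of_nat v * of_nat d + of_nat i) = of_nat (p v i)) \<and>
     (\<forall>v<n. s 3 (of_nat v) = (if v \<in> A then 1 else 0)) \<and>
     holds_list s 1 (encode_triples cs)"

lemma config_upd [simp]:
  "a \<notin> {0, 1, 2, 3} \<Longrightarrow> config (s(a := f)) p A cs \<longleftrightarrow> config s p A cs"
  by (simp add: config_def holds_list_def)

lemma config_cong:
  "config s p A cs \<Longrightarrow> (\<And>v i. v < n \<Longrightarrow> i < d \<Longrightarrow> p v i = q v i) \<Longrightarrow> config s q A cs"
  by (simp add: config_def)

lemma config_level:
  "config s p A cs \<Longrightarrow> v < n \<Longrightarrow> i < d \<Longrightarrow> s 2 (of_nat v * of_nat d + of_nat i) = of_nat (p v i)"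
  by (simp add: config_def)

lemma config_set_level:
  assumes "config s p A cs" "v < n" "i < d"
  shows "config (s(2 := (s 2)(of_nat v * of_nat d + of_nat i := of_nat x))) (p(v := (p v)(i := x))) A cs"
  using assms unfolding config_def holds_list_def by (auto simp: index_eq_iff)

lemma config_inp: "config s p A cs \<Longrightarrow> s 0 = inp"
  by (simp add: config_def)

lemma w_nat_le: "k \<le> 3 * n \<Longrightarrow> w (of_nat k) \<le> W"
  using w_of_nat[of k] bounds by linarith

lemma runs_push:
  assumes xs: "holds_list s 1 xs" and len: "length xs < 3 * n"
    and x: "val e s = x" "w x \<le> W"
    and Q: "\<And>f. holds_list (s(1 := f)) 1 (xs @ [x]) \<Longrightarrow> Q (s(1 := f))"
  shows "runs (push e) s Q"
  unfolding push_def
proof (intro runs_Seq runs_Write)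
  let ?e = "Add (cell0 1) (Const 1)"
  let ?s = "s(1 := (s 1)(val ?e s := val e s))"
  show "w (val e s) \<le> W" using x by simp
  have l: "s 1 0 = of_nat (length xs)" using xs by (simp add: holds_list_def)
  have pos: "(of_nat (length xs) + 1 :: 'a) \<noteq> 0"
    by (metis of_nat_eq_0_iff nat.simps(3) of_nat_Suc add.commute)
  have e: "val ?e ?s = of_nat (length xs) + 1" using l pos by simp
  show "w (val ?e ?s) \<le> W"
    unfolding e using w_nat_le[of "Suc (length xs)"] len by (simp add: add.commute)
  show "Q (?s(1 := (?s 1)(val (Const 0) ?s := val ?e ?s)))"
    unfolding e using Q[of "(s 1)(of_nat (length xs) + 1 := x, 0 := of_nat (length xs) + 1)"]
      holds_list_snoc[OF xs, of x] l x by simp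
qed

lemma runs_compare_cells:
  assumes c: "config s p A cs" and s: "s 6 0 = of_nat v" "s 7 0 = of_nat u" and uv: "u < n" "v < n"
    and Q: "\<And>f g. 0 < g 0 \<longleftrightarrow> same_cell d p u v \<Longrightarrow> Q (s(8 := f, 9 := g))"
  shows "runs compare_cells s Q"
  unfolding compare_cells_def
proof (intro runs_Seq runs_Write)
  show "w (val (Const 1) s) \<le> W" using w_nat_le[of 1] uv by simp
  let ?s = "s(9 := (s 9)(val (Const 0) s := val (Const 1) s))"
  define I where "I k s' \<longleftrightarrow> (\<exists>f g. s' = s(8 := f, 9 := g) \<and> f 0 = of_nat k \<and>
    g 0 = (if \<forall>i<k. p u i = p v i then 1 else 0))" for k and s' :: "'a store"
  show "runs (For 8 dim (Cond (Equal (level (cell0 7) (cell0 8)) (level (cell0 6) (cell0 8)))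
        Skip (Write 9 (Const 0) (Const 0)))) ?s Q"
  proof (rule runs_For[where I = I and n = d])
    show "d \<le> N" "d + 2 \<le> W" by (rule bounds)+
    show "s' 8 0 = of_nat k \<and> val dim s' = of_nat d" if "I k s'" for k s'
      using that c by (auto simp: I_def config_inp inp_dim)
    show "I 0 (?s(8 := (?s 8)(0 := 0)))"
      unfolding I_def by (intro exI[of _ "(s 8)(0 := 0)"] exI[of _ "(s 9)(0 := 1)"]) (simp add: fun_upd_twist)
    show "Q s'" if "I d s'" for s'
    proof -
      from that obtain f g where fg: "s' = s(8 := f, 9 := g)" "g 0 = (if \<forall>i<d. p u i = p v i then 1 else 0)"
        unfolding I_def by blast
      then have "0 < g 0 \<longleftrightarrow> same_cell d p u v" by (simp add: same_cell_def)
      then show ?thesis using Q fg by blast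
    qed
  next
    fix k s' assume k: "k < d" and "I k s'"
    then obtain f g where fg: "s' = s(8 := f, 9 := g)" "f 0 = of_nat k"
      "g 0 = (if \<forall>i<k. p u i = p v i then 1 else 0)"
      unfolding I_def by blast
    have eq: "holds (Equal (level (cell0 7) (cell0 8)) (level (cell0 6) (cell0 8))) s' \<longleftrightarrow> p u k = p v k"
      using c s uv k by (auto simp: fg config_inp inp_dim config_level)
    show "runs (Cond (Equal (level (cell0 7) (cell0 8)) (level (cell0 6) (cell0 8))) Skip (Write 9 (Const 0) (Const 0))) s'
      (\<lambda>s'. s' 8 0 = of_nat k \<and> I (Suc k) (s'(8 := (s' 8)(0 := of_nat (Suc k)))))"
    proof (rule runs_Cond, unfold eq)
      assume "p u k = p v k"
      then have "I (Suc k) (s'(8 := (s' 8)(0 := of_nat (Suc k))))"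
        unfolding I_def using fg
        by (intro exI[of _ "f(0 := of_nat (Suc k))"] exI[of _ g]) (auto simp: fun_upd_twist less_Suc_eq)
      then show "runs Skip s' (\<lambda>s'. s' 8 0 = of_nat k \<and> I (Suc k) (s'(8 := (s' 8)(0 := of_nat (Suc k)))))"
        using fg by (intro runs_Skip) simp
    next
      assume ne: "p u k \<noteq> p v k"
      show "runs (Write 9 (Const 0) (Const 0)) s'
        (\<lambda>s'. s' 8 0 = of_nat k \<and> I (Suc k) (s'(8 := (s' 8)(0 := of_nat (Suc k)))))"
      proof (rule runs_Write)
        show "w (val (Const 0) s') \<le> W" using w_nat_le[of 0] by simp
        have "I (Suc k) (s'(9 := g(0 := 0), 8 := f(0 := of_nat (Suc k))))"
          unfolding I_def using fg ne
          by (intro exI[of _ "f(0 := of_nat (Suc k))"] exI[of _ "g(0 := 0)"]) (auto simp: fun_upd_twist)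
        then show "(s'(9 := (s' 9)(val (Const 0) s' := val (Const 0) s'))) 8 0 = of_nat k \<and>
          I (Suc k) ((s'(9 := (s' 9)(val (Const 0) s' := val (Const 0) s')))
            (8 := ((s'(9 := (s' 9)(val (Const 0) s' := val (Const 0) s'))) 8)(0 := of_nat (Suc k))))"
          using fg by simp
      qed
    qed
  qed
qed

lemma runs_merge_vertex:
  assumes c: "config s p A cs" and s: "s 6 0 = of_nat v" and v: "v < n"
    and A: "A \<subseteq> {..<n}" "card A + length cs \<le> n"
    and Q: "\<And>s' A' cs'. s' 4 = s 4 \<Longrightarrow> s' 5 = s 5 \<Longrightarrow> s' 6 = s 6 \<Longrightarrow> config s' p A' cs' \<Longrightarrow>
      (A' = A \<and> cs' = cs \<and> (v \<in> A \<longrightarrow> (\<forall>u\<in>A. u \<noteq> v \<longrightarrow> \<not> same_cell d p u v))) \<or>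
      (\<exists>u\<in>A. v \<in> A \<and> u \<noteq> v \<and> same_cell d p u v \<and> A' = A - {v} \<and> cs' = cs @ [(u, v, u)]) \<Longrightarrow> Q s'"
  shows "runs merge_vertex s Q"
proof -
  \<comment> \<open>Either no \<open>u < k\<close> was suitable and nothing has changed, or the
    single merge has happened; in the latter case \<open>v\<close> has left \<open>A'\<close> and
    the remaining rounds do nothing.\<close>
  define D where "D k A' cs' \<longleftrightarrow>
    (A' = A \<and> cs' = cs \<and> (v \<in> A \<longrightarrow> (\<forall>u\<in>A. u < k \<longrightarrow> u \<noteq> v \<longrightarrow> \<not> same_cell d p u v))) \<or>
    (\<exists>u\<in>A. v \<in> A \<and> u \<noteq> v \<and> same_cell d p u v \<and> A' = A - {v} \<and> cs' = cs @ [(u, v, u)])" for k A' cs'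
  define F where "F s' \<longleftrightarrow> s' 4 = s 4 \<and> s' 5 = s 5 \<and> s' 6 = s 6" for s' :: "'a store"
  define I where "I k s' \<longleftrightarrow> F s' \<and> s' 7 0 = of_nat k \<and> (\<exists>A' cs'. config s' p A' cs' \<and> D k A' cs')"
    for k and s' :: "'a store"
  show ?thesis
    unfolding merge_vertex_def
  proof (rule runs_For[where I = I and n = n])
    show "n \<le> N" "n + 2 \<le> W" using bounds by auto
    show "s' 7 0 = of_nat k \<and> val num s' = of_nat n" if "I k s'" for k s'
      using that by (auto simp: I_def config_inp inp_num)
    show "I 0 (s(7 := (s 7)(0 := 0)))"
      unfolding I_def using c by (auto simp: F_def D_def)
    show "Q s'" if I: "I n s'" for s'
    proof -
      from I obtain A' cs' where "F s'" and *: "config s' p A' cs'" "D n A' cs'" unfolding I_def by blast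
      then have F: "s' 4 = s 4" "s' 5 = s 5" "s' 6 = s 6" by (simp_all add: F_def)
      show ?thesis
        by (rule Q[OF F *(1)]) (use *(2) A(1) in \<open>auto simp: D_def subset_iff\<close>)
    qed
  next
    fix k s1 assume k: "k < n" and "I k s1"
    then obtain A' cs' where F: "F s1" and s1: "s1 7 0 = of_nat k" and c1: "config s1 p A' cs'" and D: "D k A' cs'"
      unfolding I_def by blast
    have s6: "s1 6 0 = of_nat v" using F s by (simp add: F_def)
    let ?R = "\<lambda>s'. s' 7 0 = of_nat k \<and> I (Suc k) (s'(7 := (s' 7)(0 := of_nat (Suc k))))"
    have R: "?R s'" if "F s'" "s' 7 0 = of_nat k" "config s' p A'' cs''" "D (Suc k) A'' cs''" for s' A'' cs''
      using that unfolding I_def F_def by auto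
    let ?b = "Conj (Less (Const 0) (Rd 3 (cell0 7))) (Conj (Less (Const 0) (Rd 3 (cell0 6)))
              (Conj (Neg (Equal (cell0 7) (cell0 6))) (Less (Const 0) (cell0 9))))"
    let ?kill = "Write 3 (cell0 6) (Const 0)"
    show "runs (Seq compare_cells (Cond ?b (Seq (push (cell0 7)) (Seq (push (cell0 6)) (Seq (push (cell0 7)) ?kill)))
        Skip)) s1 ?R"
    proof (rule runs_Seq, rule runs_compare_cells[OF c1 s6 s1 k v])
      fix f g :: "'a \<Rightarrow> 'a" assume g: "(0 < g 0) = same_cell d p k v"
      let ?s = "s1(8 := f, 9 := g)"
      have c2: "config ?s p A' cs'" using c1 by simp
      have F2: "F ?s" using F by (simp add: F_def)
      have b: "holds ?b ?s \<longleftrightarrow> k \<in> A' \<and> v \<in> A' \<and> k \<noteq> v \<and> same_cell d p k v"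
        using c2 s1 s6 k v g by (auto simp: config_def)
      show "runs (Cond ?b (Seq (push (cell0 7)) (Seq (push (cell0 6)) (Seq (push (cell0 7)) ?kill))) Skip) ?s ?R"
      proof (rule runs_Cond, unfold b)
        assume *: "k \<in> A' \<and> v \<in> A' \<and> k \<noteq> v \<and> same_cell d p k v"
        then have A': "A' = A" "cs' = cs" using D by (auto simp: D_def)
        \<comment> \<open>A remaining vertex and \<open>card A + length cs \<le> n\<close> leave
          room for one more triple in the output.\<close>
        have "0 < card A" using * A A' finite_subset[OF A(1)] by (auto simp: card_gt_0_iff)
        then have len: "length (encode_triples cs :: 'a list) + 3 \<le> 3 * n"
          using A(2) by (simp add: encode_triples_def length_concat comp_def split_beta sum_list_triv)
        define xs where "xs = (encode_triples cs :: 'a list)"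
        have xs: "holds_list ?s 1 xs" using c2 A' by (simp add: config_def xs_def)
        show "runs (Seq (push (cell0 7)) (Seq (push (cell0 6)) (Seq (push (cell0 7)) ?kill))) ?s ?R"
        proof (rule runs_Seq, rule runs_push[OF xs, where x = "of_nat k"])
          show "length xs < 3 * n" using len by (simp add: xs_def)
          show "val (cell0 7) ?s = of_nat k" "w (of_nat k) \<le> W" using s1 k by (simp_all add: w_nat_le)
          fix f1 assume "holds_list (?s(1 := f1)) 1 (xs @ [of_nat k])"
          then show "runs (Seq (push (cell0 6)) (Seq (push (cell0 7)) ?kill)) (?s(1 := f1)) ?R"
          proof (rule_tac runs_Seq, rule_tac runs_push[where x = "of_nat v"])
            show "length (xs @ [of_nat k]) < 3 * n" using len by (simp add: xs_def)
            show "val (cell0 6) (?s(1 := f1)) = of_nat v" "w (of_nat v) \<le> W" using s6 v by (simp_all add: w_nat_le)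
            fix f2 assume "holds_list (?s(1 := f1, 1 := f2)) 1 ((xs @ [of_nat k]) @ [of_nat v])"
            then show "runs (Seq (push (cell0 7)) ?kill) (?s(1 := f1, 1 := f2)) ?R"
            proof (rule_tac runs_Seq, rule_tac runs_push[where x = "of_nat k"])
              show "length ((xs @ [of_nat k]) @ [of_nat v]) < 3 * n" using len by (simp add: xs_def)
              show "val (cell0 7) (?s(1 := f1, 1 := f2)) = of_nat k" "w (of_nat k) \<le> W"
                using s1 k by (simp_all add: w_nat_le)
              fix f3
              let ?t = "?s(1 := f1, 1 := f2, 1 := f3)"
              assume hl: "holds_list ?t 1 (((xs @ [of_nat k]) @ [of_nat v]) @ [of_nat k])"
              let ?t' = "?t(3 := (?t 3)(val (cell0 6) ?t := val (Const 0) ?t))"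
              have cfg: "config ?t' p (A - {v}) (cs @ [(k, v, k)])"
                using c2 hl s6 unfolding config_def A' by (auto simp: holds_list_def encode_triples_def xs_def)
              have "D (Suc k) (A - {v}) (cs @ [(k, v, k)])" using * A' by (auto simp: D_def)
              moreover have "F ?t'" using F2 by (simp add: F_def)
              ultimately have "?R ?t'" using s1 by (intro R[OF _ _ cfg]) simp_all
              moreover have "w (val (Const 0) ?t) \<le> W" using w_nat_le[of 0] by simp
              ultimately show "runs ?kill ?t ?R" by (intro runs_Write)
            qed
          qed
        qed
      next
        assume ne: "\<not> (k \<in> A' \<and> v \<in> A' \<and> k \<noteq> v \<and> same_cell d p k v)"
        have "D (Suc k) A' cs'"
          using D ne unfolding D_def by (auto simp: less_Suc_eq)
        then have "?R ?s" using s1 R[of ?s A' cs'] F2 c2 by simp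
        then show "runs Skip ?s ?R" by (rule runs_Skip[where Q = "?R" and s = "?s"])
      qed
    qed
  qed
qed

lemma runs_mark_vertices:
  assumes c: "config s p {} []" and Q: "\<And>s'. config s' p (set vs) [] \<Longrightarrow> Q s'"
  shows "runs mark_vertices s Q"
  unfolding mark_vertices_def
proof (rule runs_For[where I = "\<lambda>k s. config s p (set (take k vs)) [] \<and> s 4 0 = of_nat k" and n = "length vs"])
  have "length vs \<le> n"
    using vs card_mono[of "{..<n}" "set vs"] by (simp add: distinct_card)
  then show "length vs \<le> N" "length vs + 2 \<le> W" using bounds by linarith+
  show "config (s(4 := (s 4)(0 := 0))) p (set (take 0 vs)) [] \<and> (s(4 := (s 4)(0 := 0))) 4 0 = of_nat 0"
    using c by simp
  show "s 4 0 = of_nat k \<and> val (Rd 0 (Add (Const 3) (Mul num dim))) s = of_nat (length vs)"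
    if "config s p (set (take k vs)) [] \<and> s 4 0 = of_nat k" for k s
    using that by (auto simp: config_inp inp_dim inp_num inp_length)
  show "Q s" if "config s p (set (take (length vs) vs)) [] \<and> s 4 0 = of_nat (length vs)" for s
    using Q that by simp
  fix k s assume k: "k < length vs" and I: "config s p (set (take k vs)) [] \<and> s 4 0 = of_nat k"
  let ?e = "Rd 0 (Add (Const 4) (Add (Mul num dim) (cell0 4)))"
  have e: "val ?e s = of_nat (vs ! k)"
    using config_inp[OF conjunct1[OF I]] I k by (simp add: inp_dim inp_num inp_vertex)
  let ?s = "s(3 := (s 3)(val ?e s := val (Const 1) s))"
  have "config ?s p (set (take (Suc k) vs)) []"
    using I k unfolding e by (auto simp: config_def holds_list_def take_Suc_conv_app_nth)
  moreover have "n > 0" using vs k by (cases vs) auto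
  ultimately show "runs (Write 3 ?e (Const 1)) s (\<lambda>s'. s' 4 0 = of_nat k \<and>
      (config (s'(4 := (s' 4)(0 := of_nat (Suc k)))) p (set (take (Suc k) vs)) [] \<and>
       (s'(4 := (s' 4)(0 := of_nat (Suc k)))) 4 0 = of_nat (Suc k)))"
    using I w_nat_le[of 1] by (intro runs_Write) auto
qed


text \<open>The relation \<open>X u j + 2 / sqrt d \<le> X v j\<close>, expressed without roots so
  that it makes sense in every ordered field, the rationals included.\<close>

definition below :: "nat \<Rightarrow> nat \<Rightarrow> nat \<Rightarrow> bool" where
  "below j u v \<longleftrightarrow> X u j < X v j \<and> 4 \<le> (X v j - X u j) * (X v j - X u j) * of_nat d"

text \<open>In round \<open>r\<close> of the computation for coordinate \<open>j\<close>, a vertex \<open>v\<close> that has already been treated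
  carries the level \<open>min (r + 1) (h v j)\<close>, any other vertex the level \<open>min r (h v j)\<close>.\<close>

lemma runs_compute_levels:
  assumes c: "config s (\<lambda>_ _. 0) A []"
    and up: "\<And>j u v. j < d \<Longrightarrow> u < n \<Longrightarrow> v < n \<Longrightarrow> below j u v \<Longrightarrow> h u j < h v j"
    and down: "\<And>j v q. j < d \<Longrightarrow> v < n \<Longrightarrow> q < h v j \<Longrightarrow> \<exists>u<n. below j u v \<and> h u j = q"
    and bound: "\<And>j v. j < d \<Longrightarrow> v < n \<Longrightarrow> h v j < n"
    and Q: "\<And>s'. config s' h A [] \<Longrightarrow> Q s'"
  shows "runs compute_levels s Q"
proof -
  define I4 where "I4 j s \<longleftrightarrow> config s (\<lambda>v i. if i < j then h v i else 0) A [] \<and> s 4 0 = of_nat j"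
    for j and s :: "'a store"
  define I5 where "I5 j r s \<longleftrightarrow>
    config s (\<lambda>v i. if i < j then h v i else if i = j then min r (h v j) else 0) A [] \<and>
    s 4 0 = of_nat j \<and> s 5 0 = of_nat r" for j r and s :: "'a store"
  define I6 where "I6 j r v s \<longleftrightarrow>
    config s (\<lambda>v' i. if i < j then h v' i else if i = j then min (if v' < v then Suc r else r) (h v' j) else 0) A [] \<and>
    s 4 0 = of_nat j \<and> s 5 0 = of_nat r \<and> s 6 0 = of_nat v" for j r v and s :: "'a store"
  define P where "P j r v x = (\<lambda>v' i. if i < j then h v' i else if i = j then
    (if v' = v then x else min (if v' < v then Suc r else r) (h v' j)) else 0)" for j r v x
  \<comment> \<open>While \<open>v\<close> is scanned its level \<open>x\<close> may be the old or
    the new one; it must be the new one once a \<open>u'\<close> of true level \<open>r\<close>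
    below \<open>v\<close> has been passed.\<close>
  define I7 where "I7 j r v u s \<longleftrightarrow>
    (\<exists>x. config s (P j r v x) A [] \<and> x \<in> {min r (h v j), min (Suc r) (h v j)} \<and>
      ((\<exists>u'<u. below j u' v \<and> h u' j = r) \<longrightarrow> x = min (Suc r) (h v j))) \<and>
    s 4 0 = of_nat j \<and> s 5 0 = of_nat r \<and> s 6 0 = of_nat v \<and> s 7 0 = of_nat u" for j r v u and s :: "'a store"
  have nb: "n \<le> N" "n + 2 \<le> W" using bounds by auto
  note inp = config_inp inp_dim inp_num
  show ?thesis
    unfolding compute_levels_def
  proof (rule runs_For[where I = I4 and n = d])
    show "d \<le> N" "d + 2 \<le> W" by (rule bounds)+
    show "s 4 0 = of_nat j \<and> val dim s = of_nat d" if "I4 j s" for j s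
      using that by (auto simp: I4_def inp)
    show "I4 0 (s(4 := (s 4)(0 := 0)))" using c by (simp add: I4_def)
    show "Q s" if "I4 d s" for s
      using that by (intro Q) (auto simp: I4_def elim: config_cong)
  next
    fix j s assume j: "j < d" and I4: "I4 j s"
    show "runs (For 5 num (For 6 num (For 7 num
     (Cond (Conj (Less (coord (cell0 7) (cell0 4)) (coord (cell0 6) (cell0 4)))
             (Conj (Neg (Less (Mul (Mul (Sub (coord (cell0 6) (cell0 4)) (coord (cell0 7) (cell0 4)))
                                        (Sub (coord (cell0 6) (cell0 4)) (coord (cell0 7) (cell0 4)))) dim) (Const 4)))
               (Equal (level (cell0 7) (cell0 4)) (cell0 5))))
        (Write 2 (index (cell0 6) (cell0 4)) (Add (cell0 5) (Const 1)))
        Skip)))) s (\<lambda>s'. s' 4 0 = of_nat j \<and> I4 (Suc j) (s'(4 := (s' 4)(0 := of_nat (Suc j)))))"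
    proof (rule runs_For[where I = "I5 j" and n = n])
      show "n \<le> N" "n + 2 \<le> W" by (rule nb)+
      show "s 5 0 = of_nat r \<and> val num s = of_nat n" if "I5 j r s" for r s
        using that by (auto simp: I5_def inp)
      show "I5 j 0 (s(5 := (s 5)(0 := 0)))"
        using I4 by (auto simp: I5_def I4_def elim!: config_cong)
      show "s 4 0 = of_nat j \<and> I4 (Suc j) (s(4 := (s 4)(0 := of_nat (Suc j))))" if I: "I5 j n s" for s
      proof -
        have "config s (\<lambda>v i. if i < Suc j then h v i else 0) A []"
        proof (rule config_cong[OF conjunct1[OF I[unfolded I5_def]]])
          fix v i assume "v < n" "i < d"
          then show "(if i < j then h v i else if i = j then min n (h v j) else 0) = (if i < Suc j then h v i else 0)"
            using bound[OF j, of v] by (auto simp: less_Suc_eq)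
        qed
        then show ?thesis using I by (simp add: I4_def I5_def)
      qed
    next
      fix r s assume r: "r < n" and I5: "I5 j r s"
      show "runs (For 6 num (For 7 num
     (Cond (Conj (Less (coord (cell0 7) (cell0 4)) (coord (cell0 6) (cell0 4)))
             (Conj (Neg (Less (Mul (Mul (Sub (coord (cell0 6) (cell0 4)) (coord (cell0 7) (cell0 4)))
                                        (Sub (coord (cell0 6) (cell0 4)) (coord (cell0 7) (cell0 4)))) dim) (Const 4)))
               (Equal (level (cell0 7) (cell0 4)) (cell0 5))))
        (Write 2 (index (cell0 6) (cell0 4)) (Add (cell0 5) (Const 1)))
        Skip))) s (\<lambda>s'. s' 5 0 = of_nat r \<and> I5 j (Suc r) (s'(5 := (s' 5)(0 := of_nat (Suc r)))))"
      proof (rule runs_For[where I = "I6 j r" and n = n])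
        show "n \<le> N" "n + 2 \<le> W" by (rule nb)+
        show "s 6 0 = of_nat v \<and> val num s = of_nat n" if "I6 j r v s" for v s
          using that by (auto simp: I6_def inp)
        show "I6 j r 0 (s(6 := (s 6)(0 := 0)))" using I5 by (auto simp: I6_def I5_def elim!: config_cong)
        show "s 5 0 = of_nat r \<and> I5 j (Suc r) (s(5 := (s 5)(0 := of_nat (Suc r))))" if I: "I6 j r n s" for s
        proof -
          have "config s (\<lambda>v i. if i < j then h v i else if i = j then min (Suc r) (h v j) else 0) A []"
            using I unfolding I6_def by (elim conjE config_cong) auto
          then show ?thesis using I by (simp add: I5_def I6_def)
        qed
      next
        fix v s assume v: "v < n" and I6: "I6 j r v s"
        show "runs (For 7 num
     (Cond (Conj (Less (coord (cell0 7) (cell0 4)) (coord (cell0 6) (cell0 4)))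
             (Conj (Neg (Less (Mul (Mul (Sub (coord (cell0 6) (cell0 4)) (coord (cell0 7) (cell0 4)))
                                        (Sub (coord (cell0 6) (cell0 4)) (coord (cell0 7) (cell0 4)))) dim) (Const 4)))
               (Equal (level (cell0 7) (cell0 4)) (cell0 5))))
        (Write 2 (index (cell0 6) (cell0 4)) (Add (cell0 5) (Const 1)))
        Skip)) s (\<lambda>s'. s' 6 0 = of_nat v \<and> I6 j r (Suc v) (s'(6 := (s' 6)(0 := of_nat (Suc v)))))"
        proof (rule runs_For[where I = "I7 j r v" and n = n])
          show "n \<le> N" "n + 2 \<le> W" by (rule nb)+
          show "s 7 0 = of_nat u \<and> val num s = of_nat n" if "I7 j r v u s" for u s
            using that by (auto simp: I7_def inp)
          have "config s (P j r v (min r (h v j))) A []"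
            using I6 unfolding I6_def by (elim conjE config_cong) (auto simp: P_def)
          then show "I7 j r v 0 (s(7 := (s 7)(0 := 0)))"
            using I6 by (auto simp: I7_def I6_def)
          show "s 6 0 = of_nat v \<and> I6 j r (Suc v) (s(6 := (s 6)(0 := of_nat (Suc v))))" if I: "I7 j r v n s" for s
          proof -
            from I obtain x where x: "config s (P j r v x) A []" "x \<in> {min r (h v j), min (Suc r) (h v j)}"
              "(\<exists>u'<n. below j u' v \<and> h u' j = r) \<longrightarrow> x = min (Suc r) (h v j)"
              unfolding I7_def by blast
            \<comment> \<open>If \<open>r < h v j\<close>, a witness of level exactly
              \<open>r\<close> has been scanned; otherwise both candidates for \<open>x\<close>
              coincide.\<close>
            have "x = min (Suc r) (h v j)"
            proof (cases "r < h v j")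
              case True
              then show ?thesis using down[OF j v] x(3) by blast
            next
              case False
              then show ?thesis using x(2) by (auto simp: min_def)
            qed
            then have "config s (\<lambda>v' i. if i < j then h v' i else if i = j then
                min (if v' < Suc v then Suc r else r) (h v' j) else 0) A []"
              using x(1) by (auto simp: P_def less_Suc_eq elim!: config_cong)
            then show ?thesis using I by (simp add: I6_def I7_def)
          qed
        next
          fix u s assume u: "u < n" and I7: "I7 j r v u s"
          then obtain x where x: "config s (P j r v x) A []" "x \<in> {min r (h v j), min (Suc r) (h v j)}"
            "(\<exists>u'<u. below j u' v \<and> h u' j = r) \<longrightarrow> x = min (Suc r) (h v j)"
            unfolding I7_def by blast
          have s: "s 4 0 = of_nat j" "s 5 0 = of_nat r" "s 6 0 = of_nat v" "s 7 0 = of_nat u"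
            using I7 by (simp_all add: I7_def)
          let ?b = "Conj (Less (coord (cell0 7) (cell0 4)) (coord (cell0 6) (cell0 4)))
             (Conj (Neg (Less (Mul (Mul (Sub (coord (cell0 6) (cell0 4)) (coord (cell0 7) (cell0 4)))
                                        (Sub (coord (cell0 6) (cell0 4)) (coord (cell0 7) (cell0 4)))) dim) (Const 4)))
               (Equal (level (cell0 7) (cell0 4)) (cell0 5)))"
          have b: "holds ?b s \<longleftrightarrow> below j u v \<and> P j r v x u j = r"
            using config_inp[OF x(1)] config_level[OF x(1) u j] s u v j
            by (auto simp: inp_dim inp_coord below_def not_less)
          have irr: "\<not> below j v v" by (simp add: below_def)
          let ?R = "\<lambda>s'. s' 7 0 = of_nat u \<and> I7 j r v (Suc u) (s'(7 := (s' 7)(0 := of_nat (Suc u))))"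
          show "runs (Cond ?b (Write 2 (index (cell0 6) (cell0 4)) (Add (cell0 5) (Const 1))) Skip) s ?R"
          proof (rule runs_Cond, unfold b)
            assume *: "below j u v \<and> P j r v x u j = r"
            then have "u \<noteq> v" using irr by blast
            \<comment> \<open>A treated \<open>u\<close> shows \<open>r\<close> only if its true
              level is \<open>r\<close>, an untreated one if its true level is at least
              \<open>r\<close>. In both cases \<open>h v j > h u j \<ge> r\<close>, so raising
              \<open>v\<close> is sound.\<close>
            then have "r \<le> h u j" using * by (auto simp: P_def min_def split: if_splits)
            then have r': "min (Suc r) (h v j) = Suc r" using up[OF j u v] * by simp
            have "config (s(2 := (s 2)(of_nat v * of_nat d + of_nat j := of_nat (Suc r))))
                ((P j r v x)(v := (P j r v x v)(j := Suc r))) A []"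
              by (rule config_set_level[OF x(1) v j])
            then have "config (s(2 := (s 2)(of_nat v * of_nat d + of_nat j := of_nat (Suc r)))) (P j r v (Suc r)) A []"
              by (rule config_cong) (auto simp: P_def)
            then show "runs (Write 2 (index (cell0 6) (cell0 4)) (Add (cell0 5) (Const 1))) s ?R"
              using s r' r config_inp[OF x(1)] w_nat_le[of "Suc r"]
              by (intro runs_Write) (auto simp: I7_def inp_dim add.commute)
          next
            assume *: "\<not> (below j u v \<and> P j r v x u j = r)"
            have "x = min (Suc r) (h v j)" if "below j u v" "h u j = r"
            proof -
              have "u \<noteq> v" using that irr by blast
              then have "P j r v x u j = r" using that by (simp add: P_def)
              then show ?thesis using that * by blast
            qed
            then have "I7 j r v (Suc u) (s(7 := (s 7)(0 := of_nat (Suc u))))"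
              unfolding I7_def using x s by (auto simp: less_Suc_eq)
            then show "runs Skip s ?R" using s by (intro runs_Skip) simp
          qed
        qed
      qed
    qed
  qed
qed

text \<open>Separates loops and memory from graph theory: the abstract \<open>Inv\<close> speaks
  about levels, remaining vertices and contractions only, and \<open>step\<close> offers exactly the
  two outcomes of a merge attempt.\<close>

lemma runs_sweep_levels:
  assumes c: "config s p A cs" and init: "Inv 0 0 0 p A cs"
    and dom: "\<And>j l v p A cs. Inv j l v p A cs \<Longrightarrow> A \<subseteq> {..<n} \<and> card A + length cs \<le> n"
    and step: "\<And>j l v p A cs p' A' cs'. j < d \<Longrightarrow> l < n \<Longrightarrow> v < n \<Longrightarrow> Inv j l v p A cs \<Longrightarrow>
      p' = (if p v j + l = n then p(v := (p v)(j := p v j - 1)) else p) \<Longrightarrow>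
      (A' = A \<and> cs' = cs \<and> (v \<in> A \<longrightarrow> (\<forall>u\<in>A. u \<noteq> v \<longrightarrow> \<not> same_cell d p' u v))) \<or>
      (\<exists>u\<in>A. v \<in> A \<and> u \<noteq> v \<and> same_cell d p' u v \<and> A' = A - {v} \<and> cs' = cs @ [(u, v, u)]) \<Longrightarrow>
      Inv j l (Suc v) p' A' cs'"
    and round: "\<And>j l p A cs. j < d \<Longrightarrow> l < n \<Longrightarrow> Inv j l n p A cs \<Longrightarrow> Inv j (Suc l) 0 p A cs"
    and phase: "\<And>j p A cs. j < d \<Longrightarrow> Inv j n 0 p A cs \<Longrightarrow> Inv (Suc j) 0 0 p A cs"
    and Q: "\<And>s p A cs. config s p A cs \<Longrightarrow> Inv d 0 0 p A cs \<Longrightarrow> Q s"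
  shows "runs sweep_levels s Q"
proof -
  define I4 where "I4 j s \<longleftrightarrow> (\<exists>p A cs. config s p A cs \<and> Inv j 0 0 p A cs) \<and> s 4 0 = of_nat j"
    for j and s :: "'a store"
  define I5 where "I5 j l s \<longleftrightarrow> (\<exists>p A cs. config s p A cs \<and> Inv j l 0 p A cs) \<and>
    s 4 0 = of_nat j \<and> s 5 0 = of_nat l" for j l and s :: "'a store"
  define I6 where "I6 j l v s \<longleftrightarrow> (\<exists>p A cs. config s p A cs \<and> Inv j l v p A cs) \<and>
    s 4 0 = of_nat j \<and> s 5 0 = of_nat l \<and> s 6 0 = of_nat v" for j l v and s :: "'a store"
  have nb: "n \<le> N" "n + 2 \<le> W" using bounds by auto
  note inp = config_inp inp_dim inp_num
  let ?c = "Seq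
     (Cond (Equal (Add (level (cell0 6) (cell0 4)) (cell0 5)) num)
        (Write 2 (index (cell0 6) (cell0 4)) (Sub (level (cell0 6) (cell0 4)) (Const 1)))
        Skip)
     merge_vertex"
  show ?thesis
    unfolding sweep_levels_def
  proof (rule runs_For[where I = I4 and n = d])
    show "d \<le> N" "d + 2 \<le> W" by (rule bounds)+
    show "s 4 0 = of_nat j \<and> val dim s = of_nat d" if "I4 j s" for j s
      using that by (auto simp: I4_def inp)
    show "I4 0 (s(4 := (s 4)(0 := 0)))" using c init by (auto simp: I4_def)
    show "Q s" if "I4 d s" for s using that Q by (auto simp: I4_def)
  next
    fix j s assume j: "j < d" and I4: "I4 j s"
    show "runs (For 5 num (For 6 num ?c)) s
      (\<lambda>s'. s' 4 0 = of_nat j \<and> I4 (Suc j) (s'(4 := (s' 4)(0 := of_nat (Suc j)))))"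
    proof (rule runs_For[where I = "I5 j" and n = n])
      show "n \<le> N" "n + 2 \<le> W" by (rule nb)+
      show "s 5 0 = of_nat l \<and> val num s = of_nat n" if "I5 j l s" for l s
        using that by (auto simp: I5_def inp)
      show "I5 j 0 (s(5 := (s 5)(0 := 0)))" using I4 by (simp add: I4_def I5_def)
      show "s 4 0 = of_nat j \<and> I4 (Suc j) (s(4 := (s 4)(0 := of_nat (Suc j))))" if "I5 j n s" for s
        using that phase[OF j] unfolding I4_def I5_def by fastforce
    next
      fix l s assume l: "l < n" and I5: "I5 j l s"
      show "runs (For 6 num ?c) s
        (\<lambda>s'. s' 5 0 = of_nat l \<and> I5 j (Suc l) (s'(5 := (s' 5)(0 := of_nat (Suc l)))))"
      proof (rule runs_For[where I = "I6 j l" and n = n])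
        show "n \<le> N" "n + 2 \<le> W" by (rule nb)+
        show "s 6 0 = of_nat v \<and> val num s = of_nat n" if "I6 j l v s" for v s
          using that by (auto simp: I6_def inp)
        show "I6 j l 0 (s(6 := (s 6)(0 := 0)))" using I5 by (simp add: I5_def I6_def)
        show "s 5 0 = of_nat l \<and> I5 j (Suc l) (s(5 := (s 5)(0 := of_nat (Suc l))))" if "I6 j l n s" for s
          using that round[OF j l] unfolding I5_def I6_def by fastforce
      next
        fix v s assume v: "v < n" and I6: "I6 j l v s"
        then obtain p A cs where c: "config s p A cs" and inv: "Inv j l v p A cs"
          unfolding I6_def by blast
        have s: "s 4 0 = of_nat j" "s 5 0 = of_nat l" "s 6 0 = of_nat v"
          using I6 by (simp_all add: I6_def)
        let ?R = "\<lambda>s'. s' 6 0 = of_nat v \<and> I6 j l (Suc v) (s'(6 := (s' 6)(0 := of_nat (Suc v))))"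
        let ?b = "Equal (Add (level (cell0 6) (cell0 4)) (cell0 5)) num"
        define p' where "p' = (if p v j + l = n then p(v := (p v)(j := p v j - 1)) else p)"
        have "holds ?b s \<longleftrightarrow> (of_nat (p v j + l) :: 'a) = of_nat n"
          using config_level[OF c v j] config_inp[OF c] s by (auto simp: inp_dim inp_num)
        then have b: "holds ?b s \<longleftrightarrow> p v j + l = n" by (simp only: of_nat_eq_iff)
        have merge: "runs merge_vertex s' ?R"
          if "config s' p' A cs" "s' 4 0 = of_nat j" "s' 5 0 = of_nat l" "s' 6 0 = of_nat v" for s'
        proof (rule runs_merge_vertex[OF that(1,4) v])
          show "A \<subseteq> {..<n}" "card A + length cs \<le> n" using dom[OF inv] by auto
          fix t A' cs' assume t: "t 4 = s' 4" "t 5 = s' 5" "t 6 = s' 6" and ct: "config t p' A' cs'"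
            and res: "(A' = A \<and> cs' = cs \<and> (v \<in> A \<longrightarrow> (\<forall>u\<in>A. u \<noteq> v \<longrightarrow> \<not> same_cell d p' u v))) \<or>
              (\<exists>u\<in>A. v \<in> A \<and> u \<noteq> v \<and> same_cell d p' u v \<and> A' = A - {v} \<and> cs' = cs @ [(u, v, u)])"
          have "Inv j l (Suc v) p' A' cs'" by (rule step[OF j l v inv p'_def res])
          then show "?R t" using ct t that by (auto simp: I6_def)
        qed
        show "runs ?c s ?R"
        proof (rule runs_Seq, rule runs_Cond, unfold b)
          assume mv: "p v j + l = n"
          then have pos: "0 < p v j" using l by linarith
          let ?e = "Sub (level (cell0 6) (cell0 4)) (Const 1)"
          have e: "val ?e s = of_nat (p v j - 1)"
            using config_level[OF c v j] config_inp[OF c] s pos by (simp add: inp_dim of_nat_diff)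
          have idx: "val (index (cell0 6) (cell0 4)) s = of_nat v * of_nat d + of_nat j"
            using config_inp[OF c] s by (simp add: inp_dim)
          have "config (s(2 := (s 2)(of_nat v * of_nat d + of_nat j := of_nat (p v j - 1)))) p' A cs"
            using config_set_level[OF c v j] mv by (simp add: p'_def)
          then have "runs merge_vertex (s(2 := (s 2)(of_nat v * of_nat d + of_nat j := of_nat (p v j - 1)))) ?R"
            by (rule merge) (use s in simp_all)
          moreover have "w (val ?e s) \<le> W" unfolding e using mv by (intro w_nat_le) simp
          ultimately show "runs (Write 2 (index (cell0 6) (cell0 4)) ?e) s (\<lambda>s'. runs merge_vertex s' ?R)"
            by (intro runs_Write) (simp_all only: e idx)
        next
          assume "\<not> p v j + l = n"
          then have "config s p' A cs" using c by (simp add: p'_def)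
          then show "runs Skip s (\<lambda>s'. runs merge_vertex s' ?R)"
            using s by (intro runs_Skip merge)
        qed
      qed
    qed
  qed
qed

end

section \<open>Correctness of the sweep\<close>

text \<open>Prefixes of contraction sequences, extended at the end as the program appends its
  output. The degree bound for the last trigraph is demanded only when it is left or when the sweep
  ends.\<close>

inductive reaches :: "nat \<Rightarrow> 'a trigraph \<Rightarrow> ('a \<times> 'a \<times> 'a) list \<Rightarrow> 'a trigraph \<Rightarrow> bool" for b T where
  "reaches b T [] T"
| "reaches b T cs T' \<Longrightarrow> \<forall>x\<in>verts T'. red_degree T' x \<le> b \<Longrightarrow> contractible u v w T' \<Longrightarrow>
     reaches b T (cs @ [(u, v, w)]) (contract u v w T')"

lemma reaches_contraction_sequence:
  assumes "reaches b T cs T'" "contraction_sequence b T' cs'"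
  shows "contraction_sequence b T (cs @ cs')"
  using assms by (induction arbitrary: cs') auto

text \<open>Invariant of the sweep when coordinate \<open>j\<close> has been lowered \<open>l\<close> times. Since all levels are below
  \<open>n\<close>, nothing is lowered in the very first pass \<open>j = l = 0\<close>; it merges the vertices that share a cell
  initially, which is why only this pass may meet two vertices in the same cell.\<close>

definition sweep_inv where
  "sweep_inv d m k n T j l v p A cs \<longleftrightarrow>
     (\<exists>T'. reaches ((3 * m) ^ d * k) T cs T' \<and> verts T' = A \<and> placed d m p T') \<and>
     A \<subseteq> {..<n} \<and> A \<noteq> {} \<and> card A + length cs \<le> n \<and> cells_le d k p A \<and>
     (\<forall>u\<in>A. (\<forall>i<j. p u i = 0) \<and> (\<forall>i<d. p u i < n) \<and>
        (j < d \<longrightarrow> p u j + l \<le> n \<and> (u < v \<longrightarrow> p u j + l < n))) \<and>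
     (\<forall>x\<in>A. \<forall>y\<in>A. x \<noteq> y \<longrightarrow> same_cell d p x y \<longrightarrow> j = 0 \<and> l = 0 \<and> v \<le> x \<and> v \<le> y)"

lemma sweep_invI:
  assumes "reaches ((3 * m) ^ d * k) T cs T'" "verts T' = A" "placed d m p T'"
    and "A \<subseteq> {..<n}" "A \<noteq> {}" "card A + length cs \<le> n" "cells_le d k p A"
    and "\<And>u i. u \<in> A \<Longrightarrow> i < j \<Longrightarrow> p u i = 0" "\<And>u i. u \<in> A \<Longrightarrow> i < d \<Longrightarrow> p u i < n"
    and "\<And>u. u \<in> A \<Longrightarrow> j < d \<Longrightarrow> p u j + l \<le> n"
    and "\<And>u. u \<in> A \<Longrightarrow> j < d \<Longrightarrow> u < v \<Longrightarrow> p u j + l < n"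
    and "\<And>x y. x \<in> A \<Longrightarrow> y \<in> A \<Longrightarrow> x \<noteq> y \<Longrightarrow> same_cell d p x y \<Longrightarrow> j = 0 \<and> l = 0 \<and> v \<le> x \<and> v \<le> y"
  shows "sweep_inv d m k n T j l v p A cs"
  unfolding sweep_inv_def
proof (intro conjI ballI impI allI exI)
  show "reaches ((3 * m) ^ d * k) T cs T'" by fact
qed (use assms in simp_all)

lemma sweep_invE:
  assumes "sweep_inv d m k n T j l v p A cs"
  obtains T' where "reaches ((3 * m) ^ d * k) T cs T'" "verts T' = A" "placed d m p T'"
    and "A \<subseteq> {..<n}" "A \<noteq> {}" "card A + length cs \<le> n" "cells_le d k p A"
    and "\<And>u i. u \<in> A \<Longrightarrow> i < j \<Longrightarrow> p u i = 0" "\<And>u i. u \<in> A \<Longrightarrow> i < d \<Longrightarrow> p u i < n"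
    and "\<And>u. u \<in> A \<Longrightarrow> j < d \<Longrightarrow> p u j + l \<le> n"
    and "\<And>u. u \<in> A \<Longrightarrow> j < d \<Longrightarrow> u < v \<Longrightarrow> p u j + l < n"
    and "\<And>x y. x \<in> A \<Longrightarrow> y \<in> A \<Longrightarrow> x \<noteq> y \<Longrightarrow> same_cell d p x y \<Longrightarrow> j = 0 \<and> l = 0 \<and> v \<le> x \<and> v \<le> y"
proof -
  note inv = assms[unfolded sweep_inv_def]
  from inv obtain T' where "reaches ((3 * m) ^ d * k) T cs T'" "verts T' = A" "placed d m p T'"
    by (elim conjE exE)
  then show ?thesis by (rule that) (use inv in simp_all)
qed

text \<open>If \<open>v\<close> is merged, the degree bound before the contraction comes from
  \<open>p\<close>, and on the surviving vertices \<open>p'\<close> equals \<open>p\<close>. If not,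
  \<open>v\<close> is alone in its new cell or has already been removed.\<close>

lemma sweep_inv_step:
  assumes m: "1 \<le> m" and k: "0 < k" and jl: "j < d" "l < n"
    and inv: "sweep_inv d m k n T j l v p A cs"
    and p': "p' = (if p v j + l = n then p(v := (p v)(j := p v j - 1)) else p)"
    and res: "(A' = A \<and> cs' = cs \<and> (v \<in> A \<longrightarrow> (\<forall>u\<in>A. u \<noteq> v \<longrightarrow> \<not> same_cell d p' u v))) \<or>
      (\<exists>u\<in>A. v \<in> A \<and> u \<noteq> v \<and> same_cell d p' u v \<and> A' = A - {v} \<and> cs' = cs @ [(u, v, u)])"
  shows "sweep_inv d m k n T j l (Suc v) p' A' cs'"
proof (rule sweep_invE[OF inv])
  let ?b = "(3 * m) ^ d * k"
  fix T'
  assume T': "reaches ?b T cs T'" "verts T' = A" "placed d m p T'"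
    and A: "A \<subseteq> {..<n}" "A \<noteq> {}" "card A + length cs \<le> n" and cells: "cells_le d k p A"
    and zero: "\<And>u i. u \<in> A \<Longrightarrow> i < j \<Longrightarrow> p u i = 0" and small: "\<And>u i. u \<in> A \<Longrightarrow> i < d \<Longrightarrow> p u i < n"
    and top: "\<And>u. u \<in> A \<Longrightarrow> j < d \<Longrightarrow> p u j + l \<le> n"
    and low: "\<And>u. u \<in> A \<Longrightarrow> j < d \<Longrightarrow> u < v \<Longrightarrow> p u j + l < n"
    and sep: "\<And>x y. x \<in> A \<Longrightarrow> y \<in> A \<Longrightarrow> x \<noteq> y \<Longrightarrow> same_cell d p x y \<Longrightarrow> j = 0 \<and> l = 0 \<and> v \<le> x \<and> v \<le> y"
  have fin: "finite A" using A(1) finite_subset by blast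
  have other: "p' x = p x" if "x \<noteq> v" for x using that by (simp add: p')
  have le: "p' x i \<le> p x i" for x i by (simp add: p')
  have pl: "placed d m p' T'"
  proof (cases "v \<in> A \<and> p v j + l = n")
    case True
    then have "p x j \<le> p v j" if "x \<in> verts T'" for x using top[of x] jl(1) that T'(2) by simp
    with True show ?thesis using placed_lower[OF T'(3) m, of j v] by (simp add: p')
  next
    case False
    then have "p' x = p x" if "x \<in> verts T'" for x using that T'(2) by (auto simp: p')
    then show ?thesis by (rule placed_cong[OF T'(3)])
  qed
  have zero': "p' u i = 0" if "u \<in> A" "i < j" for u i
    using zero[OF that] le[of u i] by simp
  have small': "p' u i < n" if "u \<in> A" "i < d" for u i
    using small[OF that] le[of u i] by simp
  have top': "p' u j + l \<le> n" if "u \<in> A" for u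
    using top[OF that jl(1)] le[of u j] by simp
  have low': "p' u j + l < n" if "u \<in> A" "u < Suc v" for u
  proof (cases "u = v")
    case True
    then show ?thesis using top[OF that(1) jl(1)] jl(2) by (auto simp: p')
  next
    case False
    then show ?thesis using low[OF that(1) jl(1)] that le[of u j] by simp
  qed
  from res show ?thesis
  proof (elim disjE conjE bexE)
    assume A': "A' = A" "cs' = cs" and new: "v \<in> A \<longrightarrow> (\<forall>u\<in>A. u \<noteq> v \<longrightarrow> \<not> same_cell d p' u v)"
    have sep': "j = 0 \<and> l = 0 \<and> Suc v \<le> x \<and> Suc v \<le> y"
      if "x \<in> A" "y \<in> A" "x \<noteq> y" "same_cell d p' x y" for x y
    proof -
      have "x \<noteq> v" using new that(1,2,3,4) by (auto simp: same_cell_def)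
      moreover have "y \<noteq> v" using new that(1,2,3,4) by blast
      ultimately show ?thesis using sep[OF that(1-3)] that(4) by (simp add: same_cell_def other)
    qed
    have "cells_le d k p' A"
    proof (cases "v \<in> A \<and> p v j + l = n")
      case True
      \<comment> \<open>Initial levels are below \<open>n\<close>, so a remaining vertex is lowered
        only when \<open>l > 0\<close>, and by then every cell has at most one vertex.\<close>
      then have "l \<noteq> 0" using small[of v j] jl(1) by auto
      then show ?thesis using sep' by (intro cells_le_one[OF fin _ k]) blast
    next
      case False
      then have eq: "p' x = p x" if "x \<in> A" for x using that by (auto simp: p')
      have "{y \<in> A. same_cell d p' y x} = {y \<in> A. same_cell d p y x}" if "x \<in> A" for x
        using eq[OF that] by (auto simp: same_cell_def eq)
      then show ?thesis using cells by (simp add: cells_le_def)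
    qed
    then show ?thesis
      unfolding A' by (intro sweep_invI[OF T'(1,2) pl A] zero' small' top' low' sep')
  next
    fix u assume u: "u \<in> A" "v \<in> A" "u \<noteq> v" and same: "same_cell d p' u v"
      and A': "A' = A - {v}" "cs' = cs @ [(u, v, u)]"
    have sub: "x \<in> A" "x \<noteq> v" if "x \<in> A'" for x using that A'(1) by auto
    have sep': "j = 0 \<and> l = 0 \<and> Suc v \<le> x \<and> Suc v \<le> y"
      if "x \<in> A'" "y \<in> A'" "x \<noteq> y" "same_cell d p' x y" for x y
    proof -
      note xy = sub[OF that(1)] sub[OF that(2)]
      have "same_cell d p x y" using that(4) xy other by (simp add: same_cell_def)
      then show ?thesis using sep[OF xy(1,3) that(3)] xy by auto
    qed
    have "cells_le d k p (verts T')" using cells T'(2) by simp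
    then have "\<forall>x\<in>verts T'. red_degree T' x \<le> ?b"
      using red_degree_placed_le[OF T'(3) _ m] by blast
    moreover have "contractible u v u T'" using u T'(2) by (simp add: contractible_def)
    ultimately have "reaches ?b T cs' (contract u v u T')"
      unfolding A'(2) by (rule reaches.intros(2)[OF T'(1)])
    moreover have "verts (contract u v u T') = A'" using verts_contract[of v u T'] u T'(2) A'(1) by simp
    moreover have "placed d m p' (contract u v u T')"
      using placed_contract[OF pl] u same T'(2) by simp
    moreover have "A' \<subseteq> {..<n}" "A' \<noteq> {}" using A(1) u A'(1) by auto
    moreover have "card A' + length cs' \<le> n"
      using A(3) u(2) fin card_gt_0_iff[of A] by (auto simp: A' card_Diff_singleton)
    moreover have "cells_le d k p' A'"
    proof -
      have "{y \<in> A'. same_cell d p' y x} = {y \<in> A'. same_cell d p y x}" if "x \<in> A'" for x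
        using other[OF sub(2)[OF that]] other sub(2) by (auto simp: same_cell_def)
      moreover have "cells_le d k p A'" using A'(1) by (intro cells_le_subset[OF cells fin]) blast
      ultimately show ?thesis by (simp add: cells_le_def)
    qed
    ultimately show ?thesis
      by (rule sweep_invI) (simp_all add: zero' small' top' low' sub sep')
  qed
qed

lemma sweep_inv_round:
  assumes j: "j < d" and inv: "sweep_inv d m k n T j l n p A cs"
  shows "sweep_inv d m k n T j (Suc l) 0 p A cs"
proof (rule sweep_invE[OF inv])
  fix T'
  assume *: "reaches ((3 * m) ^ d * k) T cs T'" "verts T' = A" "placed d m p T'"
    "A \<subseteq> {..<n}" "A \<noteq> {}" "card A + length cs \<le> n" "cells_le d k p A"
    "\<And>u i. u \<in> A \<Longrightarrow> i < j \<Longrightarrow> p u i = 0" "\<And>u i. u \<in> A \<Longrightarrow> i < d \<Longrightarrow> p u i < n"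
    and low: "\<And>u. u \<in> A \<Longrightarrow> j < d \<Longrightarrow> u < n \<Longrightarrow> p u j + l < n"
    and sep: "\<And>x y. x \<in> A \<Longrightarrow> y \<in> A \<Longrightarrow> x \<noteq> y \<Longrightarrow> same_cell d p x y \<Longrightarrow> j = 0 \<and> l = 0 \<and> n \<le> x \<and> n \<le> y"
  have lt: "u < n" if "u \<in> A" for u using that *(4) by auto
  show ?thesis
  proof (rule sweep_invI[OF *])
    show "p u j + Suc l \<le> n" if "u \<in> A" for u using low[OF that j lt[OF that]] by simp
    show "j = 0 \<and> Suc l = 0 \<and> 0 \<le> x \<and> 0 \<le> y" if "x \<in> A" "y \<in> A" "x \<noteq> y" "same_cell d p x y" for x y
      using sep[OF that] lt[OF that(1)] by simp
  qed simp_all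
qed

text \<open>After \<open>n\<close> passes \<open>p u j + n \<le> n\<close> forces level
  \<open>0\<close>. The exemption for shared cells has expired because
  \<open>l = n > 0\<close>.\<close>

lemma sweep_inv_phase:
  assumes j: "j < d" "0 < n" and inv: "sweep_inv d m k n T j n 0 p A cs"
  shows "sweep_inv d m k n T (Suc j) 0 0 p A cs"
proof (rule sweep_invE[OF inv])
  fix T'
  assume *: "reaches ((3 * m) ^ d * k) T cs T'" "verts T' = A" "placed d m p T'"
    "A \<subseteq> {..<n}" "A \<noteq> {}" "card A + length cs \<le> n" "cells_le d k p A"
    and zero: "\<And>u i. u \<in> A \<Longrightarrow> i < j \<Longrightarrow> p u i = 0"
    and small: "\<And>u i. u \<in> A \<Longrightarrow> i < d \<Longrightarrow> p u i < n"
    and top: "\<And>u. u \<in> A \<Longrightarrow> j < d \<Longrightarrow> p u j + n \<le> n"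
    and sep: "\<And>x y. x \<in> A \<Longrightarrow> y \<in> A \<Longrightarrow> x \<noteq> y \<Longrightarrow> same_cell d p x y \<Longrightarrow> j = 0 \<and> n = 0 \<and> 0 \<le> x \<and> 0 \<le> y"
  show ?thesis
  proof (rule sweep_invI[OF *])
    show "p u i = 0" if "u \<in> A" "i < Suc j" for u i
      using zero[OF that(1), of i] top[OF that(1) j(1)] that(2) by (cases "i = j") simp_all
    show "p u (Suc j) + 0 \<le> n" if "u \<in> A" "Suc j < d" for u
      using small[OF that] by simp
    show "Suc j = 0 \<and> (0::nat) = 0 \<and> 0 \<le> x \<and> 0 \<le> y" if "x \<in> A" "y \<in> A" "x \<noteq> y" "same_cell d p x y" for x y
      using sep[OF that] j(2) by simp
  qed (simp_all add: small)
qed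

text \<open>All levels vanish, so all vertices share one cell; with \<open>j = d > 0\<close> shared
  cells are no longer exempted, hence one vertex is left.\<close>

lemma sweep_inv_final:
  assumes inv: "sweep_inv d m k n T d 0 0 p A cs" and d: "0 < d" and m: "1 \<le> m"
  shows "contraction_sequence ((3 * m) ^ d * k) T cs"
proof (rule sweep_invE[OF inv])
  let ?b = "(3 * m) ^ d * k"
  fix T'
  assume T': "reaches ?b T cs T'" "verts T' = A" "placed d m p T'"
    and "A \<noteq> {}" and cells: "cells_le d k p A"
    and zero: "\<And>u i. u \<in> A \<Longrightarrow> i < d \<Longrightarrow> p u i = 0"
    and sep: "\<And>x y. x \<in> A \<Longrightarrow> y \<in> A \<Longrightarrow> x \<noteq> y \<Longrightarrow> same_cell d p x y \<Longrightarrow> d = 0 \<and> (0::nat) = 0 \<and> 0 \<le> x \<and> 0 \<le> y"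
  have "x = y" if "x \<in> A" "y \<in> A" for x y
    using sep[OF that] zero that d by (auto simp: same_cell_def)
  then have "card A = 1" using \<open>A \<noteq> {}\<close> is_singletonI'[of A] by (simp add: is_singleton_altdef)
  moreover have "cells_le d k p (verts T')" using cells T'(2) by simp
  then have "\<forall>x\<in>verts T'. red_degree T' x \<le> ?b"
    using red_degree_placed_le[OF T'(3) _ m] by blast
  ultimately have "contraction_sequence ?b T' []" using T'(2) by simp
  from reaches_contraction_sequence[OF T'(1) this] show ?thesis by simp
qed

section \<open>The input and the main theorem\<close>

lemma concat_nth_uniform:
  assumes "\<forall>x\<in>set xs. length x = d" "v < length xs" "j < d"
  shows "concat xs ! (v * d + j) = xs ! v ! j"
  using assms
proof (induction xs arbitrary: v)
  case (Cons x xs)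
  then show ?case by (cases v) (auto simp: nth_append)
qed simp

lemma length_concat_uniform:
  assumes "\<forall>x\<in>set xs. length x = d"
  shows "length (concat xs) = length xs * d"
  using assms by (induction xs) auto

text \<open>Squaring is reversible because of the sign test \<open>0 < x\<close>, which the program
  performs as a separate comparison.\<close>

lemma two_div_sqrt_le_iff:
  assumes "0 < d"
  shows "0 < x \<and> 4 \<le> x * x * real d \<longleftrightarrow> 2 / sqrt (real d) \<le> x"
proof -
  have d: "0 < sqrt (real d)" using assms by simp
  have iff: "2 / sqrt (real d) \<le> x \<longleftrightarrow> 2 \<le> x * sqrt (real d)" using d by (simp add: divide_le_eq)
  have sq: "x * x * real d = (x * sqrt (real d))\<^sup>2" by (simp add: power2_eq_square algebra_simps)
  show ?thesis
  proof
    assume *: "0 < x \<and> 4 \<le> x * x * real d"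
    then have "2\<^sup>2 \<le> (x * sqrt (real d))\<^sup>2" unfolding sq[symmetric] by simp
    moreover have "0 \<le> x * sqrt (real d)" using * d by simp
    ultimately have "2 \<le> x * sqrt (real d)" by (rule power2_le_imp_le)
    then show "2 / sqrt (real d) \<le> x" using iff by simp
  next
    assume x: "2 / sqrt (real d) \<le> x"
    have "0 < 2 / sqrt (real d)" using d by simp
    with x have "0 < x" by linarith
    have "2 \<le> x * sqrt (real d)" using x iff by blast
    then have "2\<^sup>2 \<le> (x * sqrt (real d))\<^sup>2" by (rule power_mono) simp
    then show "0 < x \<and> 4 \<le> x * x * real d" unfolding sq[symmetric] using \<open>0 < x\<close> by simp
  qed
qed

lemma init_store_nth: "i < length xs \<Longrightarrow> init_store xs 0 (of_nat (Suc i)) = xs ! i"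
  using init_store_holds_list[of xs] by (simp add: holds_list_def)

lemma init_store_other: "a \<noteq> 0 \<Longrightarrow> init_store xs a i = 0"
  by (simp add: init_store_def)

text \<open>Yields the initial weight bound, which concerns every cell of the memory.\<close>

lemma init_store_values: "init_store xs a i \<in> insert 0 (insert (of_nat (length xs)) (set xs))"
proof -
  let ?m = "map_of (zip (map of_nat [0..<Suc (length xs)]) (of_nat (length xs) # xs))"
  have m: "x \<in> set (of_nat (length xs) # xs)" if "?m i = Some x" for x
    using map_of_SomeD[OF that] by (rule set_zip_rightD)
  show ?thesis
  proof (cases "a = 0")
    case True
    then have eq: "init_store xs a i = (case ?m i of None \<Rightarrow> 0 | Some x \<Rightarrow> x)"
      by (simp add: init_store_def del: upt_Suc)
    show ?thesis
    proof (cases "?m i")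
      case None
      show ?thesis unfolding eq None by simp
    next
      case (Some x)
      show ?thesis using m[OF Some] unfolding eq Some by simp
    qed
  qed (simp add: init_store_other)
qed

section \<open>Offsets in the encoded input, one less than the corresponding cells of array
  0\<close>

lemma encode_nth:
  fixes xs :: "'a::linordered_field list list" and k :: nat and vs :: "nat list" and es :: "(nat \<times> nat) list"
  assumes xs: "\<forall>x\<in>set xs. length x = d"
  defines "e \<equiv> encode (d, k, xs, vs, es)"
  shows "length xs * d + length vs + 3 \<le> length e" "e ! 0 = of_nat d" "e ! 1 = of_nat (length xs)"
    "v < length xs \<Longrightarrow> j < d \<Longrightarrow> e ! (2 + (v * d + j)) = xs ! v ! j"
    "e ! (2 + length xs * d) = of_nat (length vs)"
    "i < length vs \<Longrightarrow> e ! (3 + (length xs * d + i)) = of_nat (vs ! i)"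
proof -
  note len = length_concat_uniform[OF xs]
  show "length xs * d + length vs + 3 \<le> length e" by (simp add: e_def len)
  show "e ! 0 = of_nat d" "e ! 1 = of_nat (length xs)" by (simp_all add: e_def)
  have e: "e ! (2 + i) = (concat xs @ of_nat (length vs) # map of_nat vs @
      of_nat (length es) # concat (map (\<lambda>(u, v). [of_nat u, of_nat v]) es)) ! i" for i
    by (simp add: e_def)
  show "e ! (2 + (v * d + j)) = xs ! v ! j" if "v < length xs" "j < d"
  proof -
    have "v * d + j < Suc v * d" using that by simp
    also have "\<dots> \<le> length xs * d" using that by (intro mult_right_mono) auto
    finally show ?thesis unfolding e using len that concat_nth_uniform[OF xs that] by (simp add: nth_append)
  qed
  show "e ! (2 + length xs * d) = of_nat (length vs)" unfolding e by (simp add: nth_append len)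
  have "3 + (length xs * d + i) = 2 + (length xs * d + Suc i)" by simp
  then show "e ! (3 + (length xs * d + i)) = of_nat (vs ! i)" if "i < length vs"
    using that by (simp only: e) (simp add: nth_append len)
qed

text \<open>Rational and real inputs are treated at once: the machine computes in \<open>'a\<close>,
  while the levels are defined from the images of the coordinates under the order embedding
  \<open>r\<close>.\<close>

theorem poly_time_contraction_sequence:
  fixes w :: "'a::linordered_field \<Rightarrow> nat" and r :: "'a \<Rightarrow> real"
  assumes "cost_model w"
    and r_diff: "\<And>x y. r (x - y) = r x - r y" and r_mult: "\<And>x y. r (x * y) = r x * r y"
    and r_of_nat: "\<And>n. r (of_nat n) = of_nat n" and r_less: "\<And>x y. r x < r y \<longleftrightarrow> x < y"
  shows "poly_time w (instances r) encode is_solution"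
proof -
  interpret cost_model w by fact
  \<comment> \<open>With \<open>S\<close> the size of the input, \<open>S\<close> bounds the rounds
    of each loop and \<open>3 * S + 5\<close> the weight of each cell, including the output length
    and the cell that holds the input length.\<close>
  obtain P where P: "\<And>x. poly P x = time_bound (poly [:0, 1:] x) (poly [:5, 3:] x) contraction_program"
    using time_bound_poly[of "[:0, 1:]" "[:5, 3:]" contraction_program] by blast
  have "\<exists>t s y. exec w contraction_program (init_store (encode I)) t s \<and> t \<le> poly P (sum_list (map w (encode I))) \<and>
      holds_list s 1 y \<and> is_solution I y" if I: "I \<in> instances r" for I
  proof -
    obtain d k xs vs es where Ieq: "I = (d, k, xs, vs, es)" by (cases I)
    define n where "n = length xs"
    define e where "e = encode I"
    define S where "S = sum_list (map w e)"
    let ?G = "listed_ball_graph r d xs" and ?H = "listed_graph vs es"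
    have d: "0 < d" and k: "0 < k" and xs: "\<forall>x\<in>set xs. length x = d" and clique: "clique_number ?G = k"
      and vs: "vs \<noteq> []" "distinct vs" and H: "subgraph ?H ?G"
      using I by (simp_all add: instances_def Ieq)
    have vs_n: "set vs \<subseteq> {..<n}"
      using H by (simp add: subgraph_def listed_graph_def listed_ball_graph_def fst_ball_graph n_def)
    then have n: "0 < n" using vs by (cases vs) auto
    have len_vs: "length vs \<le> n" using vs_n vs card_mono[of "{..<n}" "set vs"] by (simp add: distinct_card)
    note enc = encode_nth[OF xs, where k = k and vs = vs and es = es, folded Ieq e_def n_def]
    have "length e \<le> S"
    proof -
      have "(\<Sum>x\<leftarrow>e. 1) \<le> (\<Sum>x\<leftarrow>e. w x)" by (rule sum_list_mono) (rule w_pos)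
      then show ?thesis by (simp add: S_def sum_list_triv)
    qed
    moreover have "n \<le> n * d" "d \<le> n * d" using d n by simp_all
    ultimately have size_le: "d \<le> S" "n \<le> S" "length e \<le> S" using enc(1) by linarith+
    define c where "c v j = (if j < d then r (xs ! v ! j) else 0)" for v j
    have c_space: "c \<in> {..<n} \<rightarrow> topspace (Euclidean_space d)"
      by (auto simp: c_def topspace_Euclidean_space)
    let ?s = "2 / sqrt (real d)"
    have s: "0 < ?s" using d by simp
    \<comment> \<open>The levels are chosen abstractly here; \<open>runs_compute_levels\<close>
      later shows that the program stores these very values.\<close>
    define hs where "hs j = (SOME h. chain_height {..<n} (\<lambda>v. c v j) ?s h)" for j
    have hs: "chain_height {..<n} (\<lambda>v. c v j) ?s (hs j)" for j
      unfolding hs_def using s by (intro someI_ex[where P = "chain_height _ _ _"] chain_height_exists) simp_all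
    interpret heights: ball_heights d "{..<n}" c "\<lambda>v j. hs j v"
      using d c_space hs by unfold_locales simp_all
    have G: "?G = ball_graph d {..<n} c" by (simp add: listed_ball_graph_def c_def[abs_def] n_def)
    interpret program_run w S "3 * S + 5" d n "init_store e 0" "\<lambda>v j. xs ! v ! j" vs
    proof
      have cell: "init_store e 0 (of_nat (Suc i)) = e ! i" if "i < length e" for i
        by (rule init_store_nth[OF that])
      show "init_store e 0 1 = of_nat d" using cell[of 0] enc(1,2) by fastforce
      show "init_store e 0 2 = of_nat n" using cell[of 1] enc(1,3) by simp
      show "init_store e 0 (3 + (of_nat v * of_nat d + of_nat i)) = xs ! v ! i" if "v < n" "i < d" for v i
      proof -
        have "v * d + i < Suc v * d" using that by simp
        also have "\<dots> \<le> n * d" using that by (intro mult_right_mono) auto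
        finally show ?thesis
          using cell[of "2 + (v * d + i)"] enc(1) enc(4)[OF that] by (simp add: numeral_eq_Suc algebra_simps)
      qed
      show "init_store e 0 (3 + of_nat n * of_nat d) = of_nat (length vs)"
        using cell[of "2 + n * d"] enc(1,5) by (simp add: algebra_simps)
      show "init_store e 0 (4 + (of_nat n * of_nat d + of_nat i)) = of_nat (vs ! i)" if "i < length vs" for i
        using cell[of "3 + (n * d + i)"] enc(1) enc(6)[OF that] that by (simp add: algebra_simps)
      show "3 * n + 2 \<le> 3 * S + 5" "d + 2 \<le> 3 * S + 5" "d \<le> S" "n \<le> S" using size_le by linarith+
    qed (use vs vs_n in simp_all)
    let ?m = "nat \<lceil>sqrt (real d)\<rceil>"
    have m: "1 \<le> ?m" using d by (simp add: Suc_le_eq)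
    let ?T = "trigraph_of ?H"
    have below: "below j u v \<longleftrightarrow> c u j + ?s \<le> c v j" if "j < d" for j u v
    proof -
      let ?x = "xs ! v ! j - xs ! u ! j"
      have "r 0 = 0" using r_of_nat[of 0] by simp
      \<comment> \<open>The numerals become images of naturals, on which \<open>r\<close> is
        known.\<close>
      have "below j u v \<longleftrightarrow> 0 < ?x \<and> \<not> ?x * ?x * of_nat d < of_nat 4" by (simp add: below_def not_less)
      also have "\<dots> \<longleftrightarrow> r 0 < r ?x \<and> \<not> r (?x * ?x * of_nat d) < r (of_nat 4)" by (simp only: r_less)
      also have "\<dots> \<longleftrightarrow> 0 < r ?x \<and> 4 \<le> r ?x * r ?x * real d"
        by (simp only: r_mult r_of_nat \<open>r 0 = 0\<close>) (simp add: not_less)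
      also have "\<dots> \<longleftrightarrow> ?s \<le> r ?x" by (rule two_div_sqrt_le_iff[OF d])
      finally show ?thesis using that by (auto simp: c_def r_diff)
    qed
    have init: "sweep_inv d ?m k n ?T 0 0 0 (\<lambda>v j. hs j v) (set vs) []"
    proof (rule sweep_invI)
      show "reaches ((3 * ?m) ^ d * k) ?T [] ?T" by (rule reaches.intros)
      show "verts ?T = set vs" by (simp add: trigraph_of_def listed_graph_def)
      show "placed d ?m (\<lambda>v j. hs j v) ?T" using heights.placed_subgraph H G by simp
      show "cells_le d k (\<lambda>v j. hs j v) (set vs)"
        using heights.cells_le_clique_number[OF vs_n] clique G by simp
      show lt: "hs i u < n" if "u \<in> set vs" for u i
        using hs[of i] that vs_n unfolding chain_height_def by auto
      show "hs 0 u + 0 \<le> n" if "u \<in> set vs" for u using lt[OF that, of 0] by simp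
    qed (use \<open>vs \<noteq> []\<close> vs vs_n len_vs in \<open>simp_all add: distinct_card\<close>)
    define Q where "Q s \<longleftrightarrow> (\<exists>cs. holds_list s 1 (encode_triples cs :: 'a list) \<and>
      contraction_sequence (width_bound d k) ?T cs)" for s :: "'a store"
    have "runs contraction_program (init_store e) Q"
      unfolding contraction_program_def
    proof (rule runs_Seq, rule runs_mark_vertices)
      show "config (init_store e) (\<lambda>_ _. 0) {} []"
        by (simp add: config_def holds_list_def init_store_other encode_triples_def)
      fix s1 assume s1: "config s1 (\<lambda>_ _. 0) (set vs) []"
      show "runs (Seq compute_levels sweep_levels) s1 Q"
      proof (rule runs_Seq, rule runs_compute_levels[OF s1, where h = "\<lambda>v j. hs j v"])
        fix j u v assume "j < d" "u < n" "v < n" "below j u v"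
        then show "hs j u < hs j v" using hs[of j] below unfolding chain_height_def by auto
      next
        fix j v q assume j: "j < d" "v < n" and q: "q < hs j v"
        obtain u where u: "u < n" "hs j u = q" "c u j + real (hs j v - q) * ?s \<le> c v j"
          using chain_height_descend[OF hs[of j], of v q] j q by auto
        \<comment> \<open>Since \<open>q < hs j v\<close>, the descent to level \<open>q\<close>
          covers at least one full step, so its end point itself is \<open>below\<close>
          \<open>v\<close>.\<close>
        have "1 * ?s \<le> real (hs j v - q) * ?s" using q s by (intro mult_right_mono) auto
        then have "below j u v" using u below[OF j(1)] by simp
        then show "\<exists>u<n. below j u v \<and> hs j u = q" using u by blast
      next
        fix j v assume "j < d" "v < n"
        then show "hs j v < n" using hs[of j] unfolding chain_height_def by auto
      next
        fix s2 assume s2: "config s2 (\<lambda>v j. hs j v) (set vs) []"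
        show "runs sweep_levels s2 Q"
        proof (rule runs_sweep_levels[where Inv = "sweep_inv d ?m k n ?T", OF s2 init])
          show "A \<subseteq> {..<n} \<and> card A + length cs \<le> n" if "sweep_inv d ?m k n ?T j l v p A cs" for j l v p A cs
            using that by (simp add: sweep_inv_def)
          show "sweep_inv d ?m k n ?T j (Suc l) 0 p A cs" if "j < d" "sweep_inv d ?m k n ?T j l n p A cs" for j l p A cs
            using that by (rule sweep_inv_round)
          show "sweep_inv d ?m k n ?T (Suc j) 0 0 p A cs" if "j < d" "sweep_inv d ?m k n ?T j n 0 p A cs" for j p A cs
            using that(1) n that(2) by (rule sweep_inv_phase)
          show "Q s" if "config s p A cs" "sweep_inv d ?m k n ?T d 0 0 p A cs" for s p A cs
            using sweep_inv_final[OF that(2) d m] that(1) unfolding Q_def config_def width_bound_def by blast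
        qed (rule sweep_inv_step[OF m k])
      qed
    qed
    moreover have "light (init_store e)"
      unfolding light_def
    proof (intro allI)
      fix a i
      have "w x \<le> 3 * S + 5" if "x \<in> set e" for x
      proof -
        have "w x \<le> S" using that unfolding S_def by (intro member_le_sum_list) auto
        then show ?thesis by linarith
      qed
      moreover have "w 0 \<le> 3 * S + 5" using w_of_nat[of 0] by simp
      moreover have "w (of_nat (length e)) \<le> 3 * S + 5"
        using w_of_nat[of "length e"] size_le(3) by linarith
      ultimately show "w (init_store e a i) \<le> 3 * S + 5"
        using init_store_values[of e a i] by auto
    qed
    ultimately obtain t s where "exec w contraction_program (init_store e) t s"
      "t \<le> time_bound S (3 * S + 5) contraction_program" "Q s"
      unfolding runs_def by blast
    moreover have "time_bound S (3 * S + 5) contraction_program = poly P S"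
      using P[of S] by (simp add: mult.commute add.commute)
    ultimately show ?thesis unfolding Q_def e_def S_def Ieq by auto
  qed
  then show ?thesis unfolding poly_time_def by blast
qed

theorem theorem4p5:
  shows "(\<forall>(d::nat) (k::nat) (G::'a graph) (H::'a graph).
            0 < d \<longrightarrow> 0 < k \<longrightarrow> is_unit_ball_graph d G \<longrightarrow> clique_number G = k \<longrightarrow>
            subgraph H G \<longrightarrow> fst H \<noteq> {} \<longrightarrow>
            twin_width H \<le> width_bound d k) \<and>
         poly_time bit_size (instances real_of_rat) encode is_solution \<and>
         poly_time unit_size (instances (\<lambda>x::real. x)) encode is_solution"
proof (intro conjI allI impI)
  fix d k and G H :: "'a graph"
  assume *: "0 < d" "0 < k" "is_unit_ball_graph d G" "clique_number G = k" "subgraph H G" "fst H \<noteq> {}"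
  have fin: "finite (fst G)"
    and ex: "\<exists>c\<in>fst G \<rightarrow> topspace (Euclidean_space d). G = ball_graph d (fst G) c"
    using *(3) by (simp_all only: is_unit_ball_graph_def)
  from ex show "twin_width H \<le> width_bound d k"
  proof (rule bexE)
    fix c assume c: "c \<in> fst G \<rightarrow> topspace (Euclidean_space d)" and G: "G = ball_graph d (fst G) c"
    show ?thesis
      using twin_width_subgraph_ball_graph_le[OF *(1) fin c, of H] *(2,4-6) unfolding G[symmetric] by simp
  qed
next
  show "poly_time bit_size (instances real_of_rat) encode is_solution"
    by (rule poly_time_contraction_sequence[OF cost_model_bit_size])
      (simp_all add: of_rat_diff of_rat_mult of_rat_less)
  show "poly_time unit_size (instances (\<lambda>x::real. x)) encode is_solution"
    by (rule poly_time_contraction_sequence[OF cost_model_unit_size]) simp_all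
qed

end
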